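(* Let $d\ge1$ be an integer. For generic tori, and also for generic rectangular tori, with coefficients $\beta=(\beta_{ij})$, the following holds for every $\epsilon>0$, with constants $C$ depending only on $\beta,\epsilon$ (and on $d$ and the cutoff $\chi$), for all $\lambda\ge1$ and $0<\delta<1$. (1) If $\delta<\lambda^{1-2d-\epsilon}$, then $$\|P_{\lambda,\delta}\|_{L^1(\mathbb{T}^d)\to L^\infty(\mathbb{T}^d)}\le C.$$ (2) If $a\in\mathbb{Z}$ with $d\le a\le 2d$ and $\lambda^{-a}\le\delta\le\lambda^{1-a}$, then $$\|P_{\lambda,\delta}\|_{L^1(\mathbb{T}^d)\to L^\infty(\mathbb{T}^d)}\le C\,\delta^{1-\frac{a+1}{d+a+1}}\,\lambda^{d-1+\frac{a+1}{d+a+1}+\epsilon}.$$ (3) If $a\in\mathbb{Z}$ with $\frac{d-1}{2}\le a<d$ and $\lambda^{-a}\le\delta\le\lambda^{1-a}$, then $$\|P_{\lambda,\delta}\|_{L^1(\mathbb{T}^d)\to L^\infty(\mathbb{T}^d)}\le C\,\delta^{1-\frac1{d+1-a}}\,\lambda^{d-1+\frac1{d+1-a}+\epsilon}.$$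
   Context: $\mathbb{T}^d=\mathbb{R}^d/\mathbb{Z}^d$. Given a real symmetric positive definite matrix $\beta=(\beta_{ij})_{1\le i,j\le d}$, let $\mathcal{Q}(x)=\sum_{i,j=1}^d\beta_{ij}x_ix_j$. Let $\chi$ be a fixed cutoff function with values in $[0,1]$, supported in $[-1,1]$ and equal to $1$ on $[-\frac12,\frac12]$. For $f=\sum_{k\in\mathbb{Z}^d}\widehat f_k e^{2\pi i k\cdot x}$ on $\mathbb{T}^d$, the spectral projector is the Fourier multiplier $$P_{\lambda,\delta}f=\sum_{k\in\mathbb{Z}^d}\chi\left(\frac{\sqrt{\mathcal{Q}(k)}-\lambda}{\delta}\right)\widehat f_k\,e^{2\pi i k\cdot x}.$$ A property holds for generic rectangular tori if, for diagonal forms $\beta_{ij}=\beta_i\delta_{ij}$, it holds for all $(\beta_i)_{1\le i\le d}$ in a subset of $[1,2]^d$ of full Lebesgue measure. A property holds for generic tori if, for $\beta_{ij}=\delta_{ij}+h_{ij}$ with $h_{ij}=h_{ji}\in[-\frac1{10d^2},\frac1{10d^2}]$, it holds for all $(h_{ij})_{1\le i\le j\le d}$ in a subset of $[-\frac1{10d^2},\frac1{10d^2}]^{d(d+1)/2}$ of full Lebesgue measure. (Here $\delta_{ij}$ is the Kronecker delta.) *)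

theory Defs
  imports "HOL-Analysis.Analysis" "HOL-Probability.Essential_Supremum"
begin

text \<open>
  Functions on the torus \<open>\<real>\<^sup>d / \<int>\<^sup>d\<close>, with \<open>d = CARD('n)\<close>, are \<open>\<int>\<^sup>d\<close>-periodic functions on
  \<open>real ^ 'n\<close>.  Norms and Fourier coefficients are computed over the closed unit cube, which
  differs from a fundamental domain by a null set.
\<close>

definition torus_periodic :: "(real ^ 'n \<Rightarrow> complex) \<Rightarrow> bool" where
  "torus_periodic f \<longleftrightarrow> (\<forall>x. \<forall>m :: int ^ 'n. f (x + (\<chi> i. of_int (m $ i))) = f x)"

definition torus_measure :: "(real ^ 'n) measure" where
  "torus_measure = lebesgue_on (cbox 0 1)"

definition torus_L1_norm :: "(real ^ 'n \<Rightarrow> complex) \<Rightarrow> ennreal" where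
  "torus_L1_norm f = (\<integral>\<^sup>+ x. ennreal (norm (f x)) \<partial>torus_measure)"

definition torus_Linf_norm :: "(real ^ 'n \<Rightarrow> complex) \<Rightarrow> ennreal" where
  "torus_Linf_norm f = esssup torus_measure (\<lambda>x. ennreal (norm (f x)))"

definition torus_L1 :: "(real ^ 'n \<Rightarrow> complex) set" where
  "torus_L1 = {f. torus_periodic f \<and> integrable torus_measure f}"

definition L1_Linf_opnorm :: "((real ^ 'n \<Rightarrow> complex) \<Rightarrow> real ^ 'n \<Rightarrow> complex) \<Rightarrow> ennreal" where
  "L1_Linf_opnorm T = (SUP f \<in> {f \<in> torus_L1. torus_L1_norm f \<le> 1}. torus_Linf_norm (T f))"

definition torus_character :: "int ^ 'n \<Rightarrow> real ^ 'n \<Rightarrow> complex" where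
  "torus_character k x = exp (2 * of_real pi * \<i> * of_real (\<Sum>i\<in>UNIV. of_int (k $ i) * x $ i))"

definition fourier_coeff :: "(real ^ 'n \<Rightarrow> complex) \<Rightarrow> int ^ 'n \<Rightarrow> complex" where
  "fourier_coeff f k = integral\<^sup>L torus_measure (\<lambda>x. f x * torus_character (- k) x)"

definition quad_form :: "real ^ 'n ^ 'n \<Rightarrow> real ^ 'n \<Rightarrow> real" where
  "quad_form \<beta> x = (\<Sum>i\<in>UNIV. \<Sum>j\<in>UNIV. \<beta> $ i $ j * x $ i * x $ j)"

text \<open>
  For positive definite \<open>\<beta>\<close>, \<open>\<delta> > 0\<close> and \<open>cutoff\<close> supported in \<open>[-1, 1]\<close>, only finitely many terms
  of the sum below are nonzero, so the unconditional sum \<open>infsum\<close> is a finite sum.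
\<close>

definition spectral_projector ::
  "(real \<Rightarrow> real) \<Rightarrow> real ^ 'n ^ 'n \<Rightarrow> real \<Rightarrow> real \<Rightarrow> (real ^ 'n \<Rightarrow> complex) \<Rightarrow> real ^ 'n \<Rightarrow> complex" where
  "spectral_projector cutoff \<beta> lam \<delta> f x =
     (\<Sum>\<^sub>\<infinity>k\<in>UNIV. of_real (cutoff ((sqrt (quad_form \<beta> (\<chi> i. of_int (k $ i))) - lam) / \<delta>))
        * fourier_coeff f k * torus_character k x)"

definition is_cutoff :: "(real \<Rightarrow> real) \<Rightarrow> bool" where
  "is_cutoff cutoff \<longleftrightarrow>
     (\<forall>t. 0 \<le> cutoff t \<and> cutoff t \<le> 1) \<and>
     closure {t. cutoff t \<noteq> 0} \<subseteq> {-1..1} \<and>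
     (\<forall>t\<in>{-1/2..1/2}. cutoff t = 1)"

definition generic_rectangular_tori :: "(real ^ 'n ^ 'n \<Rightarrow> bool) \<Rightarrow> bool" where
  "generic_rectangular_tori P \<longleftrightarrow>
     (AE b in (lborel :: (real ^ 'n) measure). b \<in> cbox 1 2 \<longrightarrow>
        P (\<chi> i j. if i = j then b $ i else 0))"

text \<open>
  A symmetric matrix \<open>h\<close> is given by its \<open>d (d + 1) / 2\<close> free entries, indexed by the unordered
  pairs \<open>{i, j}\<close> (singletons for the diagonal) instead of the ordered pairs with \<open>i \<le> j\<close>, so that
  no order on the index type is needed.
\<close>

definition index_pairs :: "'n set set" where
  "index_pairs = {{i, j} | i j. True}"

definition generic_tori :: "(real ^ 'n ^ 'n \<Rightarrow> bool) \<Rightarrow> bool" where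
  "generic_tori P \<longleftrightarrow>
     (AE h in PiM (index_pairs :: 'n set set) (\<lambda>_. lborel :: real measure).
        (\<forall>p\<in>index_pairs. \<bar>h p\<bar> \<le> 1 / (10 * real CARD('n) ^ 2)) \<longrightarrow>
        P (\<chi> i j. (if i = j then 1 else 0) + h {i, j}))"

end

theory Submission
  imports Defs
begin

text \<open>
  The kernel of \<open>P\<^sub>\<lambda>\<^sub>,\<^sub>\<delta>\<close> is a trigonometric polynomial with coefficients in \<open>[0, 1]\<close>, so its norm from
  \<open>L\<^sup>1\<close> to \<open>L\<^sup>\<infinity>\<close> is at most the number \<open>N\<close> of lattice points \<open>k\<close> with \<open>\<bar>\<surd>Q(k) - \<lambda>\<bar> \<le> \<delta>\<close>
  (lemma \<open>L1_Linf_opnorm_le_card\<close>).  These points have \<open>\<bar>k\<^sub>i\<bar> \<le> 3\<lambda>\<close> and \<open>\<bar>Q(k) - \<lambda>\<^sup>2\<bar> \<le> 3\<delta>\<lambda>\<close>, and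
  everything rests on the following bound, valid for almost every form when \<open>1 \<le> r < d\<close>
  (lemma \<open>AE_card_shell_le\<close>):

  \<open>N \<le> C (\<lambda>\<^sup>r\<^sup>-\<^sup>1 + \<delta> \<lambda>\<^sup>d\<^sup>-\<^sup>1 (\<lambda>/\<delta>)\<^sup>1\<^sup>/\<^sup>(\<^sup>r\<^sup>+\<^sup>1\<^sup>)\<^sup>+\<^sup>\<epsilon>)\<close>.

  The case \<open>r = 1\<close> gives the first two estimates, the case \<open>r = d - a\<close> gives the third
  (lemma \<open>shell_boundsI\<close>).  In dimension one a shell contains at most ten points.

  To prove the bound, freeze the off-diagonal coefficients, so that
  \<open>Q(k) = b \<bullet> v(k) + q(k)\<close> with \<open>v(k) = (k\<^sub>i\<^sup>2)\<^sub>i\<close>, \<open>q\<close> fixed and only the diagonal \<open>b\<close> random.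
  If \<open>k\<^sub>0, \<dots>, k\<^sub>r\<close> lie in a common shell, then \<open>b\<close> satisfies the \<open>r\<close> conditions
  \<open>\<bar>b \<bullet> (v(k\<^sub>j) - v(k\<^sub>0)) + c\<^sub>j\<bar> \<le> \<eta>\<close> with \<open>\<eta>\<close> of size \<open>\<delta>\<lambda>\<close>, which confines it to a set of volume at most
  \<open>2\<^sup>d \<eta>\<^sup>r / \<bar>D\<bar>\<close> for any nonzero \<open>r \<times> r\<close> minor \<open>D\<close> of the matrix with rows \<open>v(k\<^sub>j) - v(k\<^sub>0)\<close>.

  The tuples are built greedily.  Each new row is reduced against the previous rows by Gaussian
  elimination, the largest remaining entry becomes the pivot, and the row is accepted only if this
  pivot is at least \<open>1\<close> in absolute value; \<open>D\<close> is the product of the pivots.  Two facts balance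
  each other.

  \<^item> There are many such tuples.  A point rejected after \<open>j\<close> steps is determined, up to boundedly many
    choices, by \<open>j\<close> of its coordinates.  So each of the \<open>r\<close> steps rejects at most \<open>O(\<lambda>\<^sup>r\<^sup>-\<^sup>1)\<close> points, and a
    shell with \<open>N\<close> points, \<open>N\<close> a large multiple of \<open>\<lambda>\<^sup>r\<^sup>-\<^sup>1\<close>, contains at least \<open>N (N/2)\<^sup>r\<close> of them
    (lemma \<open>card_chains_ge\<close>).
  \<^item> On average there are few.  The sum of \<open>1/\<bar>D\<bar>\<close> over all tuples in a box of side \<open>\<lambda>\<close> with a given
    \<open>k\<^sub>0\<close> is at most \<open>\<lambda>\<^sup>r\<^sup>(\<^sup>d\<^sup>-\<^sup>2\<^sup>)\<close> up to logarithms (lemma \<open>sum_chains_le\<close>).  The reason is that before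
    each step two columns are still free.  If \<open>x\<close> and \<open>y\<close> are the coordinates of the new point there,
    the pivot is at least the geometric mean of \<open>max(1, \<bar>x\<^sup>2 - c\<bar>)\<close> and \<open>max(1, \<bar>y\<^sup>2 - c'\<bar>)\<close>, where \<open>c\<close>
    and \<open>c'\<close> do not depend on \<open>x\<close> and \<open>y\<close>; and the sum of \<open>max(1, \<bar>n\<^sup>2 - c\<bar>)\<^sup>-\<^sup>1\<^sup>/\<^sup>2\<close> over \<open>\<bar>n\<bar> \<le> \<lambda>\<close> is only
    logarithmic.

  Thus the expected number of tuples in a common shell is at most
  \<open>(\<delta>\<lambda>)\<^sup>r \<lambda>\<^sup>d \<lambda>\<^sup>r\<^sup>(\<^sup>d\<^sup>-\<^sup>2\<^sup>)\<close> up to logarithms.  Summing over dyadic \<open>\<lambda>\<close> and \<open>\<delta>\<close> after a normalisation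
  that loses \<open>(\<lambda>/\<delta>)\<^sup>\<epsilon>\<close> shows that almost surely the actual number obeys the same bound, and the
  \<open>(r+1)\<close>-st root of it is the main term above.
\<close>

section \<open>Lattice points in a box\<close>

definition lattice_box :: "nat \<Rightarrow> (int ^ 'n) set" where
  "lattice_box m = {k. \<forall>i. \<bar>k $ i\<bar> \<le> int m}"

lemma vec_product_set:
  fixes Z :: "'n::finite \<Rightarrow> 'a set"
  assumes "\<And>i. finite (Z i)"
  shows "finite {k :: 'a ^ 'n. \<forall>i. k $ i \<in> Z i}"
    and "card {k :: 'a ^ 'n. \<forall>i. k $ i \<in> Z i} = (\<Prod>i\<in>UNIV. card (Z i))"
proof -
  have eq: "{k :: 'a ^ 'n. \<forall>i. k $ i \<in> Z i} = vec_lambda ` (PiE UNIV Z)"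
  proof (intro set_eqI iffI)
    fix k :: "'a ^ 'n"
    assume "k \<in> {k. \<forall>i. k $ i \<in> Z i}"
    then have "vec_nth k \<in> PiE UNIV Z" by auto
    moreover have "k = vec_lambda (vec_nth k)" by simp
    ultimately show "k \<in> vec_lambda ` (PiE UNIV Z)" by blast
  qed auto
  have inj: "inj_on (vec_lambda :: ('n \<Rightarrow> 'a) \<Rightarrow> 'a ^ 'n) (PiE UNIV Z)"
    by (metis inj_onI vec_lambda_inverse UNIV_I)
  show "finite {k :: 'a ^ 'n. \<forall>i. k $ i \<in> Z i}"
    unfolding eq by (intro finite_imageI finite_PiE) (use assms in auto)
  show "card {k :: 'a ^ 'n. \<forall>i. k $ i \<in> Z i} = (\<Prod>i\<in>UNIV. card (Z i))"
    unfolding eq card_image[OF inj] by (simp add: card_PiE)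
qed

lemma lattice_box_altdef: "lattice_box m = {k :: int ^ 'n. \<forall>i. k $ i \<in> {- int m..int m}}"
  unfolding lattice_box_def by (simp add: abs_le_iff) (metis minus_le_iff)

lemma finite_lattice_box [simp, intro]: "finite (lattice_box m :: (int ^ 'n::finite) set)"
  unfolding lattice_box_altdef by (rule vec_product_set) simp

lemma card_lattice_box: "card (lattice_box m :: (int ^ 'n::finite) set) = (2 * m + 1) ^ CARD('n)"
  unfolding lattice_box_altdef
  by (subst vec_product_set) (auto simp: nat_add_distrib nat_mult_distrib)

lemma card_le_fibers:
  assumes "finite Y" "f ` X \<subseteq> Y" "finite X"
    and "\<And>y. y \<in> Y \<Longrightarrow> card {x \<in> X. f x = y} \<le> c"
  shows "card X \<le> c * card Y"
proof -
  have "card X = (\<Sum>x\<in>X. 1)" by simp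
  also have "\<dots> = (\<Sum>y\<in>Y. \<Sum>x\<in>{x \<in> X. f x = y}. 1)"
    by (rule sum.group[OF assms(3,1,2), symmetric])
  also have "\<dots> \<le> (\<Sum>y\<in>Y. c)" by (intro sum_mono) (use assms(4) in auto)
  also have "\<dots> = c * card Y" by simp
  finally show ?thesis .
qed

text \<open>
  An open interval of length two contains at most two integers, and each is the square of at most
  two integers.
\<close>

lemma card_squares_near:
  fixes c :: real
  shows "finite {n :: int. \<bar>(of_int n)\<^sup>2 - c\<bar> < 1}" "card {n :: int. \<bar>(of_int n)\<^sup>2 - c\<bar> < 1} \<le> 4"
proof -
  have roots: "finite {n :: int. n\<^sup>2 = u} \<and> card {n :: int. n\<^sup>2 = u} \<le> 2" for u
  proof (cases "\<exists>s. s\<^sup>2 = u")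
    case True
    then obtain s where s: "s\<^sup>2 = u" by blast
    have sub: "{n :: int. n\<^sup>2 = u} \<subseteq> {s, -s}" using s by (auto simp: power2_eq_iff)
    have "card {s, -s} \<le> 2" by (simp add: card_insert_if)
    then show ?thesis using sub by (meson card_mono finite.emptyI finite.insertI finite_subset le_trans)
  next
    case False
    then have "{n :: int. n\<^sup>2 = u} = {}" by auto
    then show ?thesis by simp
  qed
  have sub: "{n :: int. \<bar>(of_int n)\<^sup>2 - c\<bar> < 1} \<subseteq> {n. n\<^sup>2 = \<lfloor>c\<rfloor>} \<union> {n. n\<^sup>2 = \<lceil>c\<rceil>}"
  proof
    fix n :: int assume "n \<in> {n :: int. \<bar>(of_int n)\<^sup>2 - c\<bar> < 1}"
    then have "\<bar>of_int (n\<^sup>2) - c\<bar> < 1" by simp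
    then have "n\<^sup>2 = \<lfloor>c\<rfloor> \<or> n\<^sup>2 = \<lceil>c\<rceil>" by linarith
    then show "n \<in> {n. n\<^sup>2 = \<lfloor>c\<rfloor>} \<union> {n. n\<^sup>2 = \<lceil>c\<rceil>}" by auto
  qed
  then show "finite {n :: int. \<bar>(of_int n)\<^sup>2 - c\<bar> < 1}"
    by (rule finite_subset) (use roots in auto)
  have "card {n :: int. \<bar>(of_int n)\<^sup>2 - c\<bar> < 1} \<le> card ({n::int. n\<^sup>2 = \<lfloor>c\<rfloor>} \<union> {n. n\<^sup>2 = \<lceil>c\<rceil>})"
    by (rule card_mono[OF _ sub]) (use roots in auto)
  also have "\<dots> \<le> 2 + 2"
    using card_Un_le roots by (meson add_mono le_trans)
  finally show "card {n :: int. \<bar>(of_int n)\<^sup>2 - c\<bar> < 1} \<le> 4" by simp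
qed

section \<open>Sums over squares near a given point\<close>

lemma harm_le_powr:
  assumes "\<tau> > 0" "m \<ge> 1"
  shows "(harm (m + 1) :: real) \<le> (1 + 2 powr \<tau> / \<tau>) * real m powr \<tau>"
proof -
  have "harm (Suc m) - ln (real (Suc m)) \<le> (harm (Suc 0) :: real) - ln (real (Suc 0))"
    using decseqD[OF decseq_harm_diff_ln, of 0 m] by simp
  then have "(harm (m + 1) :: real) \<le> 1 + ln (real (m + 1))"
    by (simp add: harm_def)
  also have "\<dots> \<le> 1 + (real (m + 1)) powr \<tau> / \<tau>"
    using ln_powr_bound[of "real (m+1)" \<tau>] assms by simp
  also have "\<dots> \<le> real m powr \<tau> + (2 * real m) powr \<tau> / \<tau>"
    using assms by (intro add_mono divide_right_mono powr_mono2) (auto simp: ge_one_powr_ge_zero)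
  also have "\<dots> = (1 + 2 powr \<tau> / \<tau>) * real m powr \<tau>"
    by (simp add: powr_mult algebra_simps)
  finally show ?thesis .
qed

text \<open>
  The distances from \<open>z\<close> of the integers on one side of \<open>z\<close> are distinct, so each side contributes at
  most a harmonic sum, wherever \<open>z\<close> lies.
\<close>

lemma sum_inverse_dist_le:
  fixes z :: int
  shows "(\<Sum>n\<in>{0..int m}. 1 / (1 + \<bar>real_of_int (n - z)\<bar>)) \<le> 2 * harm (m + 1)"
proof -
  have harm: "(\<Sum>u\<in>{0..int m}. 1 / (1 + real_of_int u)) = harm (m + 1)"
  proof -
    have "(\<Sum>u\<in>{0..int m}. 1 / (1 + real_of_int u)) = (\<Sum>k<m+1. 1 / (1 + real k))"
      by (rule sum.reindex_bij_witness[of _ int nat]) auto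
    also have "\<dots> = harm (m + 1)"
      unfolding harm_altdef by (simp add: inverse_eq_divide add.commute)
    finally show ?thesis .
  qed
  have upper: "(\<Sum>n\<in>{n\<in>{0..int m}. z \<le> n}. 1 / (1 + \<bar>real_of_int (n - z)\<bar>)) \<le> harm (m + 1)"
  proof -
    define a where "a = max z 0"
    have "(\<Sum>n\<in>{n\<in>{0..int m}. z \<le> n}. 1 / (1 + \<bar>real_of_int (n - z)\<bar>))
        \<le> (\<Sum>n\<in>{n\<in>{0..int m}. z \<le> n}. 1 / (1 + real_of_int (n - a)))"
      by (intro sum_mono divide_left_mono) (auto simp: a_def max_def intro!: mult_pos_pos)
    also have "\<dots> = (\<Sum>u\<in>(\<lambda>n. n - a) ` {n\<in>{0..int m}. z \<le> n}. 1 / (1 + real_of_int u))"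
      by (subst sum.reindex) (auto simp: inj_on_def)
    also have "\<dots> \<le> (\<Sum>u\<in>{0..int m}. 1 / (1 + real_of_int u))"
      by (intro sum_mono2) (auto simp: a_def max_def)
    finally show ?thesis using harm by simp
  qed
  have lower: "(\<Sum>n\<in>{n\<in>{0..int m}. \<not> z \<le> n}. 1 / (1 + \<bar>real_of_int (n - z)\<bar>)) \<le> harm (m + 1)"
  proof -
    define a where "a = min z (int m)"
    have "(\<Sum>n\<in>{n\<in>{0..int m}. \<not> z \<le> n}. 1 / (1 + \<bar>real_of_int (n - z)\<bar>))
        \<le> (\<Sum>n\<in>{n\<in>{0..int m}. \<not> z \<le> n}. 1 / (1 + real_of_int (a - n)))"
      by (intro sum_mono divide_left_mono) (auto simp: a_def min_def intro!: mult_pos_pos)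
    also have "\<dots> = (\<Sum>u\<in>(\<lambda>n. a - n) ` {n\<in>{0..int m}. \<not> z \<le> n}. 1 / (1 + real_of_int u))"
      by (subst sum.reindex) (auto simp: inj_on_def)
    also have "\<dots> \<le> (\<Sum>u\<in>{0..int m}. 1 / (1 + real_of_int u))"
      by (intro sum_mono2) (auto simp: a_def min_def)
    finally show ?thesis using harm by simp
  qed
  have "(\<Sum>n\<in>{0..int m}. 1 / (1 + \<bar>real_of_int (n - z)\<bar>)) =
      (\<Sum>n\<in>{n\<in>{0..int m}. z \<le> n}. 1 / (1 + \<bar>real_of_int (n - z)\<bar>)) +
      (\<Sum>n\<in>{n\<in>{0..int m}. \<not> z \<le> n}. 1 / (1 + \<bar>real_of_int (n - z)\<bar>))"
    by (subst sum.union_disjoint[symmetric]) (auto intro!: sum.cong rev_finite_subset[of "{0..int m}"])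
  then show ?thesis using upper lower by simp
qed

text \<open>
  For \<open>c = s\<^sup>2\<close> one has \<open>\<bar>n\<^sup>2 - c\<bar> = \<bar>\<bar>n\<bar> - s\<bar> (\<bar>n\<bar> + s) \<ge> (\<bar>n\<bar> - s)\<^sup>2\<close>, so the square root turns the sum
  into a harmonic one; for negative \<open>c\<close> the same bound holds with \<open>s = 0\<close>.  It is essential that
  the bound is uniform in \<open>c\<close>.
\<close>

lemma sum_inverse_sqrt_squares_le:
  fixes c :: real
  shows "(\<Sum>n\<in>{- int m..int m}. 1 / sqrt (max 1 \<bar>(of_int n)\<^sup>2 - c\<bar>)) \<le> 12 * harm (m + 1)"
proof -
  define s where "s = sqrt (max c 0)"
  define z where "z = \<lfloor>s\<rfloor>"
  let ?g = "\<lambda>n::int. 3 / (1 + \<bar>real_of_int (n - z)\<bar>)"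
  have term_le: "1 / sqrt (max 1 \<bar>(of_int n)\<^sup>2 - c\<bar>) \<le> ?g \<bar>n\<bar>" for n :: int
  proof -
    let ?t = "\<bar>\<bar>real_of_int n\<bar> - s\<bar>"
    have s0: "s \<ge> 0" by (simp add: s_def)
    have "?t\<^sup>2 \<le> \<bar>(of_int n)\<^sup>2 - c\<bar>"
    proof (cases "c \<ge> 0")
      case True
      then have c: "c = s\<^sup>2" by (simp add: s_def)
      have "(of_int n)\<^sup>2 - c = (\<bar>real_of_int n\<bar> - s) * (\<bar>real_of_int n\<bar> + s)"
        unfolding c by (simp add: power2_eq_square algebra_simps)
      then have "\<bar>(of_int n)\<^sup>2 - c\<bar> = ?t * (\<bar>real_of_int n\<bar> + s)"
        using s0 by (simp add: abs_mult)
      moreover have "?t \<le> \<bar>real_of_int n\<bar> + s" using s0 by linarith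
      then have "?t\<^sup>2 \<le> ?t * (\<bar>real_of_int n\<bar> + s)"
        unfolding power2_eq_square by (rule mult_left_mono) simp
      ultimately show ?thesis by simp
    next
      case False
      then show ?thesis by (simp add: s_def)
    qed
    then have "(max 1 ?t)\<^sup>2 \<le> max 1 \<bar>(of_int n)\<^sup>2 - c\<bar>"
      by (simp add: max_def)
    then have "max 1 ?t \<le> sqrt (max 1 \<bar>(of_int n)\<^sup>2 - c\<bar>)"
      by (rule real_le_rsqrt)
    moreover have "(1 + \<bar>real_of_int (\<bar>n\<bar> - z)\<bar>) / 3 \<le> max 1 ?t"
    proof -
      have "real_of_int z \<le> s" "s < real_of_int z + 1" unfolding z_def by linarith+
      then have "\<bar>real_of_int (\<bar>n\<bar> - z)\<bar> \<le> ?t + 1" by linarith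
      then show ?thesis by (simp add: max_def)
    qed
    ultimately have "(1 + \<bar>real_of_int (\<bar>n\<bar> - z)\<bar>) / 3 \<le> sqrt (max 1 \<bar>(of_int n)\<^sup>2 - c\<bar>)" by linarith
    then have "1 / sqrt (max 1 \<bar>(of_int n)\<^sup>2 - c\<bar>) \<le> 1 / ((1 + \<bar>real_of_int (\<bar>n\<bar> - z)\<bar>) / 3)"
      by (intro divide_left_mono) (auto intro!: mult_pos_pos simp: add_pos_nonneg)
    then show ?thesis by simp
  qed
  have "(\<Sum>n\<in>{- int m..int m}. 1 / sqrt (max 1 \<bar>(of_int n)\<^sup>2 - c\<bar>)) \<le> (\<Sum>n\<in>{- int m..int m}. ?g \<bar>n\<bar>)"
    by (intro sum_mono term_le)
  also have "\<dots> \<le> (\<Sum>n\<in>{0..int m} \<union> uminus ` {0..int m}. ?g \<bar>n\<bar>)"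
    by (intro sum_mono2) (auto simp: image_iff intro: bexI[of _ "- _"])
  also have "\<dots> \<le> (\<Sum>n\<in>{0..int m}. ?g \<bar>n\<bar>) + (\<Sum>n\<in>uminus ` {0..int m}. ?g \<bar>n\<bar>)"
    by (subst sum_Un) (auto intro!: sum_nonneg)
  also have "(\<Sum>n\<in>uminus ` {0..int m}. ?g \<bar>n\<bar>) = (\<Sum>n\<in>{0..int m}. ?g \<bar>n\<bar>)"
    by (subst sum.reindex) auto
  also have "(\<Sum>n\<in>{0..int m}. ?g \<bar>n\<bar>) = 3 * (\<Sum>n\<in>{0..int m}. 1 / (1 + \<bar>real_of_int (n - z)\<bar>))"
    by (simp add: sum_distrib_left)
  finally show ?thesis using sum_inverse_dist_le[of z m] by linarith
qed

section \<open>Coordinates in a basis of rows\<close>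

definition row_update :: "'a ^ 'n ^ 'n \<Rightarrow> 'n \<Rightarrow> 'a ^ 'n \<Rightarrow> 'a ^ 'n ^ 'n" where
  "row_update M i w = (\<chi> l. if l = i then w else M $ l)"

text \<open>
  The coefficients of \<open>w\<close> as a linear combination of the rows of \<open>M\<close>.
\<close>

definition row_coords :: "real ^ 'n ^ 'n \<Rightarrow> real ^ 'n \<Rightarrow> real ^ 'n" where
  "row_coords M w = matrix_inv (transpose M) *v w"

lemma matrix_inv_inverse:
  fixes A :: "real ^ 'n ^ 'n"
  assumes "invertible A"
  shows "A ** matrix_inv A = mat 1" "matrix_inv A ** A = mat 1"
  using someI_ex[OF assms[unfolded invertible_def]] unfolding matrix_inv_def by auto

lemma transpose_mult_row_coords:
  assumes "det M \<noteq> 0"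
  shows "transpose M *v row_coords M w = w"
proof -
  have "invertible (transpose M)" using assms by (simp add: invertible_det_nz)
  then show ?thesis
    unfolding row_coords_def
    by (metis matrix_inv_inverse(1) matrix_vector_mul_assoc matrix_vector_mul_lid)
qed

lemma row_coords_transpose_mult:
  assumes "det M \<noteq> 0"
  shows "row_coords M (transpose M *v y) = y"
proof -
  have "invertible (transpose M)" using assms by (simp add: invertible_det_nz)
  then show ?thesis
    unfolding row_coords_def
    by (metis matrix_inv_inverse(2) matrix_vector_mul_assoc matrix_vector_mul_lid)
qed

text \<open>
  Cramer's rule: replacing a row multiplies the determinant by the coordinate of the new row along
  the old one.  This identifies the determinant of the final matrix with the product of the pivots.
\<close>

lemma det_row_update:
  assumes "det M \<noteq> 0"
  shows "det (row_update M i w) = row_coords M w $ i * det M"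
proof -
  let ?y = "row_coords M w"
  have "w = (\<Sum>l\<in>UNIV. ?y $ l *s row l M)"
    using transpose_mult_row_coords[OF assms, of w]
    by (simp add: vec_eq_iff matrix_vector_mult_def transpose_def row_def sum_component mult.commute)
  then have "row_update M i w = (\<chi> l. if l = i then \<Sum>l\<in>UNIV. ?y $ l *s row l M else row l M)"
    by (simp add: row_update_def vec_eq_iff row_def)
  then show ?thesis using cramer_lemma_transpose[of i ?y M] by simp
qed

text \<open>
  When the rows outside \<open>I\<close> are still unit vectors, a vector supported outside \<open>I\<close> is its own
  coordinate vector.  So the reduced entries of \<open>w\<close> differ from the original entries by a quantity
  that depends only on the restriction of \<open>w\<close> to \<open>I\<close>.
\<close>

lemma row_coords_eq_offset:
  assumes "det M \<noteq> 0" and unit: "\<And>l. l \<notin> I \<Longrightarrow> M $ l = axis l 1"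
    and agree: "\<And>l. l \<in> I \<Longrightarrow> w $ l = w' $ l"
  shows "row_coords M w $ i - w $ i = row_coords M w' $ i - w' $ i"
proof -
  let ?u = "w - w'"
  have "transpose M *v ?u = ?u"
  proof (rule vec_eq_iff[THEN iffD2], rule allI)
    fix i
    have "(transpose M *v ?u) $ i = (\<Sum>l\<in>UNIV. M $ l $ i * ?u $ l)"
      by (simp add: matrix_vector_mult_def transpose_def)
    also have "\<dots> = (\<Sum>l\<in>UNIV. if l = i then ?u $ l else 0)"
    proof (rule sum.cong)
      fix l
      show "M $ l $ i * ?u $ l = (if l = i then ?u $ l else 0)"
        by (cases "l \<in> I") (auto simp: agree unit axis_def)
    qed simp
    also have "\<dots> = ?u $ i" by simp
    finally show "(transpose M *v ?u) $ i = ?u $ i" .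
  qed
  then have "row_coords M ?u = ?u" using row_coords_transpose_mult[OF assms(1), of ?u] by simp
  then have "row_coords M w - row_coords M w' = w - w'"
    by (simp add: row_coords_def matrix_vector_mult_diff_distrib)
  then have "(row_coords M w - row_coords M w') $ i = (w - w') $ i" by simp
  then show ?thesis by simp
qed

section \<open>Chains of lattice points\<close>

definition square_vec :: "int ^ 'n \<Rightarrow> real ^ 'n" where
  "square_vec k = (\<chi> i. (of_int (k $ i))\<^sup>2)"

lemma square_vec_nth [simp]: "square_vec k $ i = (of_int (k $ i))\<^sup>2"
  by (simp add: square_vec_def)

text \<open>
  The set \<open>I\<close> contains the pivot columns used so far.  The entries of \<open>row_coords M w\<close> outside \<open>I\<close> are
  what Gaussian elimination leaves of \<open>w\<close>.  Because the pivot is the largest of them, its inverse can be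
  bounded in terms of any two free entries; and a vector for which no column qualifies has all its
  free entries smaller than \<open>1\<close>.
\<close>

definition pivot_step :: "real ^ 'n ^ 'n \<Rightarrow> 'n set \<Rightarrow> 'n \<Rightarrow> real ^ 'n \<Rightarrow> bool" where
  "pivot_step M I i w \<longleftrightarrow> i \<notin> I \<and> 1 \<le> \<bar>row_coords M w $ i\<bar> \<and>
     (\<forall>j. j \<notin> I \<longrightarrow> \<bar>row_coords M w $ j\<bar> \<le> \<bar>row_coords M w $ i\<bar>)"

text \<open>
  A chain is stored as a list of pairs of a pivot column and a lattice point, the latest first.  The
  row of the matrix at a pivot column is the difference of square vectors of the corresponding
  point and the base point; all other rows stay unit vectors, so that the matrix is square and its
  determinant is the minor of interest.
\<close>

fun chain_matrix :: "int ^ 'n \<Rightarrow> ('n \<times> (int ^ 'n)) list \<Rightarrow> real ^ 'n ^ 'n" where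
  "chain_matrix k0 [] = mat 1"
| "chain_matrix k0 ((i, k) # L) = row_update (chain_matrix k0 L) i (square_vec k - square_vec k0)"

fun pivot_chain :: "int ^ 'n \<Rightarrow> ('n \<times> (int ^ 'n)) list \<Rightarrow> bool" where
  "pivot_chain k0 [] \<longleftrightarrow> True"
| "pivot_chain k0 ((i, k) # L) \<longleftrightarrow> pivot_chain k0 L \<and>
     pivot_step (chain_matrix k0 L) (fst ` set L) i (square_vec k - square_vec k0)"

lemma chain_matrix_props:
  assumes "pivot_chain k0 L"
  shows "1 \<le> \<bar>det (chain_matrix k0 L)\<bar>" "distinct (map fst L)"
    "l \<notin> fst ` set L \<Longrightarrow> chain_matrix k0 L $ l = axis l 1"
    "(i, k) \<in> set L \<Longrightarrow> chain_matrix k0 L $ i = square_vec k - square_vec k0"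
proof -
  have "1 \<le> \<bar>det (chain_matrix k0 L)\<bar> \<and> distinct (map fst L) \<and>
    (\<forall>l. l \<notin> fst ` set L \<longrightarrow> chain_matrix k0 L $ l = axis l 1) \<and>
    (\<forall>(i, k) \<in> set L. chain_matrix k0 L $ i = square_vec k - square_vec k0)"
    using assms
  proof (induction L)
    case Nil
    then show ?case by (auto simp: det_I) (auto simp: mat_def axis_def vec_eq_iff)
  next
    case (Cons e L)
    obtain i k where e: "e = (i, k)" by force
    let ?M = "chain_matrix k0 L" and ?w = "square_vec k - square_vec k0"
    have IH: "1 \<le> \<bar>det ?M\<bar>" "distinct (map fst L)"
      "\<And>l. l \<notin> fst ` set L \<Longrightarrow> ?M $ l = axis l 1"
      "\<And>i k. (i, k) \<in> set L \<Longrightarrow> ?M $ i = square_vec k - square_vec k0"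
      using Cons e by auto
    have step: "pivot_step ?M (fst ` set L) i ?w" using Cons e by simp
    have "det ?M \<noteq> 0" using IH(1) by auto
    then have "\<bar>det (row_update ?M i ?w)\<bar> = \<bar>row_coords ?M ?w $ i\<bar> * \<bar>det ?M\<bar>"
      by (simp add: det_row_update abs_mult)
    moreover have "1 * 1 \<le> \<bar>row_coords ?M ?w $ i\<bar> * \<bar>det ?M\<bar>"
      using step IH(1) by (intro mult_mono) (auto simp: pivot_step_def)
    ultimately have "1 \<le> \<bar>det (row_update ?M i ?w)\<bar>" by simp
    moreover have "i \<notin> fst ` set L" using step by (simp add: pivot_step_def)
    ultimately show ?case
      using IH unfolding e by (auto simp: row_update_def image_iff)
  qed
  then show "1 \<le> \<bar>det (chain_matrix k0 L)\<bar>" "distinct (map fst L)"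
    "l \<notin> fst ` set L \<Longrightarrow> chain_matrix k0 L $ l = axis l 1"
    "(i, k) \<in> set L \<Longrightarrow> chain_matrix k0 L $ i = square_vec k - square_vec k0"
    by blast+
qed

lemma chain_det_nonzero: "pivot_chain k0 L \<Longrightarrow> det (chain_matrix k0 L) \<noteq> 0"
  using chain_matrix_props(1) by fastforce

lemma card_pivots: "pivot_chain k0 L \<Longrightarrow> card (fst ` set L) = length L"
  by (metis chain_matrix_props(2) distinct_card length_map list.set_map)

definition extensions :: "int ^ 'n \<Rightarrow> (int ^ 'n) set \<Rightarrow> ('n \<times> (int ^ 'n)) list \<Rightarrow> ('n \<times> (int ^ 'n)) set" where
  "extensions k0 S L = {(i, k). k \<in> S \<and> pivot_chain k0 ((i, k) # L)}"

definition pivot_chains :: "int ^ 'n \<Rightarrow> (int ^ 'n) set \<Rightarrow> nat \<Rightarrow> ('n \<times> (int ^ 'n)) list set" where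
  "pivot_chains k0 S r = {L. length L = r \<and> pivot_chain k0 L \<and> snd ` set L \<subseteq> S}"

lemma finite_extensions: "finite S \<Longrightarrow> finite (extensions k0 S (L :: ('n::finite \<times> (int ^ 'n)) list))"
  unfolding extensions_def by (rule finite_subset[of _ "UNIV \<times> S"]) auto

lemma finite_chains:
  assumes "finite S"
  shows "finite (pivot_chains k0 S r :: ('n::finite \<times> (int ^ 'n)) list set)"
proof (rule finite_subset)
  show "pivot_chains k0 S r \<subseteq> {L. set L \<subseteq> UNIV \<times> S \<and> length L = r}"
    unfolding pivot_chains_def by (auto simp: image_subset_iff)
  show "finite {L. set L \<subseteq> (UNIV :: 'n set) \<times> S \<and> length L = r}"
    by (rule finite_lists_length_eq) (use assms in simp)
qed

lemma chains_0 [simp]: "pivot_chains k0 S 0 = {[]}"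
  by (auto simp: pivot_chains_def)

lemma sum_chains_Suc:
  assumes "finite S"
  shows "(\<Sum>L\<in>pivot_chains k0 S (Suc r). F L) = (\<Sum>L\<in>pivot_chains k0 S r. \<Sum>e\<in>extensions k0 S L. F (e # L))"
proof -
  have "pivot_chains k0 S (Suc r) = (\<lambda>(L, e). e # L) ` Sigma (pivot_chains k0 S r) (extensions k0 S)"
  proof (intro set_eqI iffI)
    fix L' assume L': "L' \<in> pivot_chains k0 S (Suc r)"
    then obtain i k L where "L' = (i, k) # L"
      unfolding pivot_chains_def by (cases L') auto
    then show "L' \<in> (\<lambda>(L, e). e # L) ` Sigma (pivot_chains k0 S r) (extensions k0 S)"
      using L' by (auto simp: pivot_chains_def extensions_def image_iff Bex_def)
  qed (force simp: pivot_chains_def extensions_def)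
  moreover have "inj_on (\<lambda>(L, e). e # L) (Sigma (pivot_chains k0 S r) (extensions k0 S))"
    by (auto simp: inj_on_def)
  ultimately have "(\<Sum>L\<in>pivot_chains k0 S (Suc r). F L)
      = (\<Sum>(L, e)\<in>Sigma (pivot_chains k0 S r) (extensions k0 S). F (e # L))"
    by (simp add: sum.reindex case_prod_unfold)
  also have "\<dots> = (\<Sum>L\<in>pivot_chains k0 S r. \<Sum>e\<in>extensions k0 S L. F (e # L))"
    using assms by (intro sum.Sigma[symmetric]) (auto simp: finite_chains finite_extensions)
  finally show ?thesis .
qed

section \<open>A set with many points contains many chains\<close>

text \<open>
  The rejected points.  By \<open>row_coords_eq_offset\<close> the coordinates of \<open>k\<close> in \<open>I\<close> determine, for every
  other coordinate, an interval of length two which must contain its square.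
\<close>

lemma card_no_pivot:
  fixes M :: "real ^ 'n ^ 'n" and k0 :: "int ^ 'n"
  assumes det: "det M \<noteq> 0" and unit: "\<And>l. l \<notin> I \<Longrightarrow> M $ l = axis l 1"
  shows "card {k \<in> lattice_box m. \<forall>j. j \<notin> I \<longrightarrow> \<bar>row_coords M (square_vec k - square_vec k0) $ j\<bar> < 1}
    \<le> 4 ^ CARD('n) * (2 * m + 1) ^ card I" (is "card ?X \<le> _")
proof -
  define f :: "int ^ 'n \<Rightarrow> int ^ 'n" where "f k = (\<chi> i. if i \<in> I then k $ i else 0)" for k
  define Y where "Y = {y :: int ^ 'n. \<forall>i. y $ i \<in> (if i \<in> I then {- int m..int m} else {0})}"
  have finY: "finite Y" unfolding Y_def by (rule vec_product_set) auto
  have "card Y = (\<Prod>i\<in>UNIV. card (if i \<in> I then {- int m..int m} else {0}))"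
    unfolding Y_def by (rule vec_product_set) auto
  also have "\<dots> = (\<Prod>i\<in>UNIV. if i \<in> I then 2 * m + 1 else 1)"
    by (intro prod.cong) (auto simp: nat_add_distrib nat_mult_distrib)
  also have "\<dots> = (2 * m + 1) ^ card I"
    by (simp add: prod.If_cases)
  finally have cardY: "card Y = (2 * m + 1) ^ card I" .
  have "card ?X \<le> 4 ^ CARD('n) * card Y"
  proof (rule card_le_fibers[OF finY])
    show "f ` ?X \<subseteq> Y" by (auto simp: f_def Y_def lattice_box_altdef)
    show "finite ?X" by simp
    fix y assume "y \<in> Y"
    define c where "c i = (of_int (y $ i))\<^sup>2 - row_coords M (square_vec y - square_vec k0) $ i" for i
    define Z where "Z i = (if i \<in> I then {y $ i} else {n. \<bar>(of_int n)\<^sup>2 - c i\<bar> < 1})" for i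
    have Z: "finite (Z i)" "card (Z i) \<le> 4" for i
      using card_squares_near[of "c i"] by (auto simp: Z_def)
    have "{k \<in> ?X. f k = y} \<subseteq> {k. \<forall>i. k $ i \<in> Z i}"
    proof (intro subsetI CollectI allI)
      fix k i assume k: "k \<in> {k \<in> ?X. f k = y}"
      have agree: "k $ l = y $ l" if "l \<in> I" for l
      proof -
        have "f k $ l = y $ l" using k by simp
        then show ?thesis using that by (simp add: f_def)
      qed
      show "k $ i \<in> Z i"
      proof (cases "i \<in> I")
        case False
        have "row_coords M (square_vec k - square_vec k0) $ i - (square_vec k - square_vec k0) $ i
            = row_coords M (square_vec y - square_vec k0) $ i - (square_vec y - square_vec k0) $ i"
          using agree by (intro row_coords_eq_offset[OF det unit]) auto
        then have "row_coords M (square_vec k - square_vec k0) $ i = (of_int (k $ i))\<^sup>2 - c i"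
          by (simp add: c_def)
        then show ?thesis using k False by (auto simp: Z_def)
      qed (use agree in \<open>auto simp: Z_def\<close>)
    qed
    then have "card {k \<in> ?X. f k = y} \<le> card {k :: int ^ 'n. \<forall>i. k $ i \<in> Z i}"
      by (intro card_mono vec_product_set Z)
    also have "\<dots> = (\<Prod>i\<in>UNIV. card (Z i))" by (intro vec_product_set Z)
    also have "\<dots> \<le> (\<Prod>i\<in>(UNIV :: 'n set). 4)" by (intro prod_mono) (use Z in auto)
    finally show "card {k \<in> ?X. f k = y} \<le> 4 ^ CARD('n)" by simp
  qed
  then show ?thesis by (simp add: cardY)
qed

lemma card_extensions_ge:
  fixes k0 :: "int ^ 'n"
  assumes "S \<subseteq> lattice_box m" "pivot_chain k0 L"
  shows "card S \<le> card (extensions k0 S L) + 4 ^ CARD('n) * (2 * m + 1) ^ length L"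
proof -
  let ?M = "chain_matrix k0 L" and ?I = "fst ` set L"
  let ?x = "\<lambda>k. row_coords ?M (square_vec k - square_vec k0)"
  let ?B = "{k \<in> lattice_box m. \<forall>j. j \<notin> ?I \<longrightarrow> \<bar>?x k $ j\<bar> < 1}"
  have finS: "finite S" using assms(1) finite_lattice_box finite_subset by blast
  have "S \<subseteq> snd ` extensions k0 S L \<union> ?B"
  proof
    fix k assume k: "k \<in> S"
    show "k \<in> snd ` extensions k0 S L \<union> ?B"
    proof (cases "\<exists>j. j \<notin> ?I \<and> 1 \<le> \<bar>?x k $ j\<bar>")
      case True
      define A where "A = (\<lambda>j. \<bar>?x k $ j\<bar>) ` (- ?I)"
      have A: "finite A" "A \<noteq> {}" using True by (auto simp: A_def)
      obtain i where i: "i \<notin> ?I" "\<bar>?x k $ i\<bar> = Max A" using Max_in[OF A] by (auto simp: A_def)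
      have max: "\<bar>?x k $ j\<bar> \<le> \<bar>?x k $ i\<bar>" if "j \<notin> ?I" for j
        unfolding i(2) by (rule Max_ge) (use that A in \<open>auto simp: A_def\<close>)
      then have "1 \<le> \<bar>?x k $ i\<bar>" using True by (meson order_trans)
      then have "(i, k) \<in> extensions k0 S L"
        using max i k assms(2) by (simp add: extensions_def pivot_step_def)
      then show ?thesis by force
    next
      case False
      then show ?thesis using k assms(1) by (auto simp: not_le)
    qed
  qed
  then have "card S \<le> card (snd ` extensions k0 S L \<union> ?B)"
    by (intro card_mono) (auto simp: finite_extensions finS)
  also have "\<dots> \<le> card (snd ` extensions k0 S L) + card ?B" by (rule card_Un_le)
  also have "\<dots> \<le> card (extensions k0 S L) + 4 ^ CARD('n) * (2 * m + 1) ^ length L"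
    using card_no_pivot[OF chain_det_nonzero[OF assms(2)] chain_matrix_props(3)[OF assms(2)], of ?I m k0]
    by (intro add_mono card_image_le finite_extensions finS) (simp_all add: card_pivots[OF assms(2)])
  finally show ?thesis .
qed

text \<open>
  Under the lower bound on \<open>card S\<close> at most half of the points of \<open>S\<close> are rejected at each of
  the first \<open>r\<close> steps.
\<close>

lemma card_chains_ge:
  fixes k0 :: "int ^ 'n"
  assumes S: "S \<subseteq> lattice_box m"
    and large: "2 * 4 ^ CARD('n) * (2 * m + 1) ^ (r - 1) \<le> card S"
    and "j \<le> r"
  shows "(real (card S) / 2) ^ j \<le> card (pivot_chains k0 S j)"
  using \<open>j \<le> r\<close>
proof (induction j)
  case (Suc j)
  have finS: "finite S" using S finite_lattice_box finite_subset by blast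
  have ext: "real (card S) / 2 \<le> card (extensions k0 S L)" if L: "L \<in> pivot_chains k0 S j" for L
  proof -
    have "length L \<le> r - 1" using L Suc.prems by (auto simp: pivot_chains_def)
    then have "(2 * m + 1) ^ length L \<le> (2 * m + 1) ^ (r - 1)" by (intro power_increasing) auto
    then have "2 * (4 ^ CARD('n) * (2 * m + 1) ^ length L) \<le> 2 * (4 ^ CARD('n) * (2 * m + 1) ^ (r - 1))"
      by (intro mult_left_mono) auto
    also have "\<dots> \<le> card S" using large by (simp only: mult.assoc)
    finally have "2 * (4 ^ CARD('n) * (2 * m + 1) ^ length L) \<le> card S" .
    moreover have "card S \<le> card (extensions k0 S L) + 4 ^ CARD('n) * (2 * m + 1) ^ length L"
      using card_extensions_ge[OF S, of k0 L] L by (simp add: pivot_chains_def)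
    ultimately have "card S \<le> 2 * card (extensions k0 S L)" by linarith
    then have "real (card S) \<le> real (2 * card (extensions k0 S L))" by (simp only: of_nat_le_iff)
    then show ?thesis by simp
  qed
  have "(real (card S) / 2) ^ Suc j = (real (card S) / 2) ^ j * (real (card S) / 2)" by simp
  also have "\<dots> \<le> card (pivot_chains k0 S j) * (real (card S) / 2)"
    using Suc by (intro mult_right_mono) auto
  also have "\<dots> = (\<Sum>L\<in>pivot_chains k0 S j. real (card S) / 2)" by simp
  also have "\<dots> \<le> (\<Sum>L\<in>pivot_chains k0 S j. real (card (extensions k0 S L)))"
    by (intro sum_mono ext)
  also have "\<dots> = card (pivot_chains k0 S (Suc j))"
    using sum_chains_Suc[OF finS, of "\<lambda>_. 1 :: real" k0 j] by simp
  finally show ?case .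
qed simp

section \<open>The weighted sum over chains\<close>

text \<open>
  With all coordinates other than \<open>j1\<close> and \<open>j2\<close> fixed, the two reduced entries are
  \<open>k\<^sub>j\<^sub>1\<^sup>2 - c\<^sub>1\<close> and \<open>k\<^sub>j\<^sub>2\<^sup>2 - c\<^sub>2\<close> with constants, so the sum over the two free coordinates factorises.
\<close>

lemma sum_inverse_coords_le:
  fixes M :: "real ^ 'n ^ 'n" and k0 :: "int ^ 'n"
  assumes det: "det M \<noteq> 0" and unit: "\<And>l. l \<notin> I \<Longrightarrow> M $ l = axis l 1"
    and j: "j1 \<notin> I" "j2 \<notin> I" "j1 \<noteq> j2"
  defines "x \<equiv> \<lambda>k. row_coords M (square_vec k - square_vec k0)"
  shows "(\<Sum>k\<in>lattice_box m. 1 / sqrt (max 1 \<bar>x k $ j1\<bar>) * (1 / sqrt (max 1 \<bar>x k $ j2\<bar>)))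
    \<le> real ((2 * m + 1) ^ (CARD('n) - 2)) * (12 * harm (m + 1))\<^sup>2"
proof -
  define f :: "int ^ 'n \<Rightarrow> int ^ 'n" where "f k = (\<chi> i. if i \<in> {j1, j2} then 0 else k $ i)" for k
  define Y where "Y = {y :: int ^ 'n. \<forall>i. y $ i \<in> (if i \<in> {j1, j2} then {0} else {- int m..int m})}"
  let ?F = "\<lambda>k. 1 / sqrt (max 1 \<bar>x k $ j1\<bar>) * (1 / sqrt (max 1 \<bar>x k $ j2\<bar>))"
  have finY: "finite Y" unfolding Y_def by (rule vec_product_set) auto
  have "card Y = (\<Prod>i\<in>UNIV. card (if i \<in> {j1, j2} then {0} else {- int m..int m}))"
    unfolding Y_def by (rule vec_product_set) auto
  also have "\<dots> = (\<Prod>i\<in>UNIV. if i \<in> {j1, j2} then 1 else 2 * m + 1)"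
    by (intro prod.cong) (auto simp: nat_add_distrib nat_mult_distrib)
  also have "\<dots> = (2 * m + 1) ^ card (- {j1, j2})"
    by (simp add: prod.If_cases Compl_eq)
  also have "card (- {j1, j2}) = CARD('n) - 2"
    using j by (simp add: Compl_eq_Diff_UNIV card_Diff_subset)
  finally have cardY: "card Y = (2 * m + 1) ^ (CARD('n) - 2)" .
  have fiber: "(\<Sum>k\<in>{k \<in> lattice_box m. f k = y}. ?F k) \<le> (12 * harm (m + 1))\<^sup>2" if "y \<in> Y" for y
  proof -
    define c where "c i = (of_int (y $ i))\<^sup>2 - row_coords M (square_vec y - square_vec k0) $ i" for i
    let ?g = "\<lambda>i n. 1 / sqrt (max 1 \<bar>(of_int n)\<^sup>2 - c i\<bar>)"
    let ?R = "{- int m..int m}"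
    let ?K = "{k \<in> lattice_box m. f k = y}"
    have xeq: "x k $ i = (of_int (k $ i))\<^sup>2 - c i" if "f k = y" "i \<in> {j1, j2}" for k i
    proof -
      have agree: "k $ l = y $ l" if "l \<in> I" for l
      proof -
        have "l \<notin> {j1, j2}" using j that by auto
        moreover have "f k $ l = y $ l" using \<open>f k = y\<close> by simp
        ultimately show ?thesis by (simp add: f_def)
      qed
      have "row_coords M (square_vec k - square_vec k0) $ i - (square_vec k - square_vec k0) $ i
          = row_coords M (square_vec y - square_vec k0) $ i - (square_vec y - square_vec k0) $ i"
        using agree by (intro row_coords_eq_offset[OF det unit]) auto
      then show ?thesis by (simp add: c_def x_def)
    qed
    have inj: "inj_on (\<lambda>k. (k $ j1, k $ j2)) ?K"
    proof (rule inj_onI)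
      fix k k' :: "int ^ 'n"
      assume k: "k \<in> ?K" "k' \<in> ?K" "(k $ j1, k $ j2) = (k' $ j1, k' $ j2)"
      have "k $ i = k' $ i" for i
      proof (cases "i \<in> {j1, j2}")
        case False
        have "f k $ i = f k' $ i" using k by simp
        then show ?thesis using False by (simp add: f_def)
      qed (use k in auto)
      then show "k = k'" by (simp add: vec_eq_iff)
    qed
    have "(\<Sum>k\<in>?K. ?F k) = (\<Sum>k\<in>?K. ?g j1 (k $ j1) * ?g j2 (k $ j2))"
      by (intro sum.cong) (auto simp: xeq)
    also have "\<dots> = (\<Sum>(a, b)\<in>(\<lambda>k. (k $ j1, k $ j2)) ` ?K. ?g j1 a * ?g j2 b)"
      by (subst sum.reindex[OF inj]) simp
    also have "\<dots> \<le> (\<Sum>(a, b)\<in>?R \<times> ?R. ?g j1 a * ?g j2 b)"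
      by (intro sum_mono2) (auto simp: lattice_box_altdef)
    also have "\<dots> = (\<Sum>a\<in>?R. ?g j1 a) * (\<Sum>b\<in>?R. ?g j2 b)"
      by (simp add: sum_product sum.cartesian_product)
    also have "\<dots> \<le> (12 * harm (m + 1)) * (12 * harm (m + 1))"
      by (intro mult_mono sum_inverse_sqrt_squares_le) (auto intro!: sum_nonneg simp: harm_nonneg)
    finally show ?thesis by (simp add: power2_eq_square)
  qed
  have "(\<Sum>k\<in>lattice_box m. ?F k) = (\<Sum>y\<in>Y. \<Sum>k\<in>{k \<in> lattice_box m. f k = y}. ?F k)"
    by (rule sum.group[OF finite_lattice_box finY, symmetric]) (auto simp: f_def Y_def lattice_box_altdef)
  also have "\<dots> \<le> (\<Sum>y\<in>Y. (12 * harm (m + 1))\<^sup>2)" by (intro sum_mono fiber)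
  finally show ?thesis by (simp add: cardY)
qed

text \<open>
  The factor by which one more point multiplies the sum of inverse determinants: a choice of the
  pivot column, the coordinates other than two free ones, and the two harmonic sums.
\<close>

definition step_weight :: "'n itself \<Rightarrow> nat \<Rightarrow> real" where
  "step_weight _ m = CARD('n) * real ((2 * m + 1) ^ (CARD('n) - 2)) * (12 * harm (m + 1))\<^sup>2"

text \<open>
  Two free columns remain before the step.  The pivot dominates \<open>1\<close> and both reduced entries there,
  hence also the geometric mean of the two truncated entries.
\<close>

lemma sum_extensions_le:
  fixes k0 :: "int ^ 'n"
  assumes L: "pivot_chain k0 L" and len: "length L + 2 \<le> CARD('n)"
  shows "(\<Sum>e\<in>extensions k0 (lattice_box m) L. 1 / \<bar>det (chain_matrix k0 (e # L))\<bar>)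
    \<le> step_weight TYPE('n) m * (1 / \<bar>det (chain_matrix k0 L)\<bar>)"
proof -
  let ?M = "chain_matrix k0 L" and ?I = "fst ` set L"
  let ?x = "\<lambda>k. row_coords ?M (square_vec k - square_vec k0)"
  have det: "det ?M \<noteq> 0" by (rule chain_det_nonzero[OF L])
  have "card (- ?I) = CARD('n) - length L" by (simp add: Compl_eq_Diff_UNIV card_Diff_subset card_pivots[OF L])
  then have "2 \<le> card (- ?I)" using len by simp
  then obtain j1 j2 where j: "j1 \<notin> ?I" "j2 \<notin> ?I" "j1 \<noteq> j2"
    by (auto simp: numeral_2_eq_2 card_le_Suc_iff)
  let ?F = "\<lambda>k. 1 / sqrt (max 1 \<bar>?x k $ j1\<bar>) * (1 / sqrt (max 1 \<bar>?x k $ j2\<bar>))"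
  have term_le: "1 / \<bar>det (chain_matrix k0 (e # L))\<bar> \<le> ?F (snd e) * (1 / \<bar>det ?M\<bar>)"
    if e: "e \<in> extensions k0 (lattice_box m) L" for e
  proof -
    obtain i k where ik: "e = (i, k)" by force
    have step: "pivot_step ?M ?I i (square_vec k - square_vec k0)"
      using e by (simp add: extensions_def ik)
    let ?a = "\<bar>?x k $ i\<bar>"
    have a: "max 1 \<bar>?x k $ j1\<bar> \<le> ?a" "max 1 \<bar>?x k $ j2\<bar> \<le> ?a"
      using step j by (auto simp: pivot_step_def)
    then have "sqrt (max 1 \<bar>?x k $ j1\<bar>) * sqrt (max 1 \<bar>?x k $ j2\<bar>) \<le> sqrt ?a * sqrt ?a"
      by (intro mult_mono) auto
    then have "1 / ?a \<le> 1 / (sqrt (max 1 \<bar>?x k $ j1\<bar>) * sqrt (max 1 \<bar>?x k $ j2\<bar>))"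
      using a by (intro divide_left_mono) (auto intro!: mult_pos_pos simp: less_max_iff_disj)
    then have "1 / ?a * (1 / \<bar>det ?M\<bar>) \<le> ?F k * (1 / \<bar>det ?M\<bar>)"
      by (intro mult_right_mono) auto
    then show ?thesis by (simp add: ik det_row_update[OF det] abs_mult)
  qed
  have "(\<Sum>e\<in>extensions k0 (lattice_box m) L. 1 / \<bar>det (chain_matrix k0 (e # L))\<bar>)
      \<le> (\<Sum>e\<in>extensions k0 (lattice_box m) L. ?F (snd e) * (1 / \<bar>det ?M\<bar>))"
    by (intro sum_mono term_le)
  also have "\<dots> \<le> (\<Sum>e\<in>(UNIV :: 'n set) \<times> lattice_box m. ?F (snd e) * (1 / \<bar>det ?M\<bar>))"
    by (intro sum_mono2) (auto simp: extensions_def)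
  also have "\<dots> = CARD('n) * (\<Sum>k\<in>lattice_box m. ?F k) * (1 / \<bar>det ?M\<bar>)"
  proof -
    have "(\<Sum>e\<in>(UNIV :: 'n set) \<times> lattice_box m. ?F (snd e) * (1 / \<bar>det ?M\<bar>))
        = (\<Sum>i\<in>(UNIV :: 'n set). \<Sum>k\<in>lattice_box m. ?F k * (1 / \<bar>det ?M\<bar>))"
      by (subst sum.cartesian_product) (simp add: case_prod_unfold)
    also have "\<dots> = (\<Sum>i\<in>(UNIV :: 'n set). (\<Sum>k\<in>lattice_box m. ?F k) * (1 / \<bar>det ?M\<bar>))"
      by (simp only: sum_distrib_right)
    also have "\<dots> = CARD('n) * (\<Sum>k\<in>lattice_box m. ?F k) * (1 / \<bar>det ?M\<bar>)"
      by (simp only: sum_constant mult.assoc)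
    finally show ?thesis .
  qed
  also have "\<dots> \<le> CARD('n) * (real ((2 * m + 1) ^ (CARD('n) - 2)) * (12 * harm (m + 1))\<^sup>2) * (1 / \<bar>det ?M\<bar>)"
    by (intro mult_right_mono mult_left_mono
        sum_inverse_coords_le[OF det chain_matrix_props(3)[OF L] j]) auto
  finally show ?thesis by (simp add: step_weight_def)
qed

lemma sum_chains_le:
  fixes k0 :: "int ^ 'n"
  assumes "r + 1 \<le> CARD('n)"
  shows "(\<Sum>L\<in>pivot_chains k0 (lattice_box m) r. 1 / \<bar>det (chain_matrix k0 L)\<bar>) \<le> step_weight TYPE('n) m ^ r"
  using assms
proof (induction r)
  case (Suc r)
  have w: "step_weight TYPE('n) m \<ge> 0" by (simp add: step_weight_def)
  have "(\<Sum>L\<in>pivot_chains k0 (lattice_box m) (Suc r). 1 / \<bar>det (chain_matrix k0 L)\<bar>)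
      = (\<Sum>L\<in>pivot_chains k0 (lattice_box m) r.
          \<Sum>e\<in>extensions k0 (lattice_box m) L. 1 / \<bar>det (chain_matrix k0 (e # L))\<bar>)"
    by (rule sum_chains_Suc) simp
  also have "\<dots> \<le> (\<Sum>L\<in>pivot_chains k0 (lattice_box m) r. step_weight TYPE('n) m * (1 / \<bar>det (chain_matrix k0 L)\<bar>))"
    using Suc.prems by (intro sum_mono sum_extensions_le) (auto simp: pivot_chains_def)
  also have "\<dots> = step_weight TYPE('n) m * (\<Sum>L\<in>pivot_chains k0 (lattice_box m) r. 1 / \<bar>det (chain_matrix k0 L)\<bar>)"
    by (simp add: sum_distrib_left)
  also have "\<dots> \<le> step_weight TYPE('n) m * step_weight TYPE('n) m ^ r"
    using Suc w by (intro mult_left_mono) auto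
  finally show ?case by simp
qed (simp add: det_I)

section \<open>Volume of the coefficients compatible with a chain\<close>

text \<open>
  The linear map that replaces the coordinate \<open>x \<bullet> e\<close> by \<open>y \<bullet> x\<close> scales Lebesgue measure by
  \<open>\<bar>y \<bullet> e\<bar>\<close>: with the other coordinates fixed it is an affine map of the line with slope \<open>y \<bullet> e\<close>.
\<close>

lemma nn_integral_replace_coordinate:
  fixes y e :: "'a :: euclidean_space"
  assumes F [measurable]: "F \<in> borel_measurable borel" and e: "e \<in> Basis" and y: "y \<bullet> e \<noteq> 0"
  shows "ennreal \<bar>y \<bullet> e\<bar> * (\<integral>\<^sup>+x. F (x + (y \<bullet> x - x \<bullet> e) *\<^sub>R e) \<partial>lborel) = (\<integral>\<^sup>+x. F x \<partial>lborel)"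
proof -
  interpret product_sigma_finite "\<lambda>_ :: 'a. lborel :: real measure" ..
  define B where "B = Basis - {e}"
  have B: "Basis = insert e B" "finite B" "e \<notin> B" using e by (auto simp: B_def)
  define s where "s g = (\<Sum>b\<in>B. g b *\<^sub>R b)" for g :: "'a \<Rightarrow> real"
  have split: "(\<Sum>b\<in>Basis. (g(e := t)) b *\<^sub>R b) = t *\<^sub>R e + s g" for g t
  proof -
    have "(\<Sum>b\<in>B. (g(e := t)) b *\<^sub>R b) = s g"
      unfolding s_def using B(3) by (intro sum.cong) auto
    then show ?thesis unfolding B(1) using B(2,3) by simp
  qed
  have se: "s g \<bullet> e = 0" for g
    unfolding s_def B_def using e by (auto simp: inner_sum_left inner_Basis intro!: sum.neutral)
  have ee: "e \<bullet> e = 1" using e by (simp add: inner_Basis)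
  have fold: "(\<integral>\<^sup>+x. G x \<partial>lborel) = (\<integral>\<^sup>+g. (\<integral>\<^sup>+t. G (t *\<^sub>R e + s g) \<partial>lborel) \<partial>Pi\<^sub>M B (\<lambda>_. lborel))"
    if [measurable]: "G \<in> borel_measurable borel" for G :: "'a \<Rightarrow> ennreal"
  proof -
    have "(\<integral>\<^sup>+x. G x \<partial>lborel) = (\<integral>\<^sup>+f. G (\<Sum>b\<in>Basis. f b *\<^sub>R b) \<partial>Pi\<^sub>M Basis (\<lambda>_. lborel))"
      by (subst lborel_eq) (simp add: nn_integral_distr)
    also have "\<dots> = (\<integral>\<^sup>+g. (\<integral>\<^sup>+t. G (\<Sum>b\<in>Basis. (g(e := t)) b *\<^sub>R b) \<partial>lborel) \<partial>Pi\<^sub>M B (\<lambda>_. lborel))"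
      unfolding B(1) by (rule product_nn_integral_insert[OF B(2,3)]) (simp add: B(1)[symmetric])
    finally show ?thesis by (simp only: split)
  qed
  have "(\<integral>\<^sup>+x. F x \<partial>lborel) = (\<integral>\<^sup>+g. (\<integral>\<^sup>+t. F (t *\<^sub>R e + s g) \<partial>lborel) \<partial>Pi\<^sub>M B (\<lambda>_. lborel))"
    by (rule fold) measurable
  also have "\<dots> = (\<integral>\<^sup>+g. ennreal \<bar>y \<bullet> e\<bar> * (\<integral>\<^sup>+t. F ((y \<bullet> s g + (y \<bullet> e) * t) *\<^sub>R e + s g) \<partial>lborel) \<partial>Pi\<^sub>M B (\<lambda>_. lborel))"
    by (intro nn_integral_cong nn_integral_real_affine y) measurable
  also have "\<dots> = (\<integral>\<^sup>+g. ennreal \<bar>y \<bullet> e\<bar> * (\<integral>\<^sup>+t. F ((t *\<^sub>R e + s g) + (y \<bullet> (t *\<^sub>R e + s g) - (t *\<^sub>R e + s g) \<bullet> e) *\<^sub>R e) \<partial>lborel) \<partial>Pi\<^sub>M B (\<lambda>_. lborel))"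
    by (intro nn_integral_cong arg_cong[where f = "(*) _"] arg_cong[where f = F])
       (simp add: inner_simps se ee algebra_simps)
  also have "\<dots> = ennreal \<bar>y \<bullet> e\<bar> * (\<integral>\<^sup>+g. (\<integral>\<^sup>+t. F ((t *\<^sub>R e + s g) + (y \<bullet> (t *\<^sub>R e + s g) - (t *\<^sub>R e + s g) \<bullet> e) *\<^sub>R e) \<partial>lborel) \<partial>Pi\<^sub>M B (\<lambda>_. lborel))"
    by (rule nn_integral_cmult) (unfold s_def, measurable)
  also have "\<dots> = ennreal \<bar>y \<bullet> e\<bar> * (\<integral>\<^sup>+x. F (x + (y \<bullet> x - x \<bullet> e) *\<^sub>R e) \<partial>lborel)"
  proof -
    have "(\<lambda>x. F (x + (y \<bullet> x - x \<bullet> e) *\<^sub>R e)) \<in> borel_measurable borel" by measurable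
    from fold[OF this] show ?thesis by simp
  qed
  finally show ?thesis by simp
qed

text \<open>
  Adding a point to a chain composes the linear map with the replacement of one coordinate, so the
  change of variables formula for chain matrices follows by induction from
  \<open>nn_integral_replace_coordinate\<close>.
\<close>

lemma nn_integral_chain_matrix:
  fixes k0 :: "int ^ 'n"
  assumes "pivot_chain k0 L" and "F \<in> borel_measurable borel"
  shows "ennreal \<bar>det (chain_matrix k0 L)\<bar> * (\<integral>\<^sup>+b. F (chain_matrix k0 L *v b) \<partial>lborel) = (\<integral>\<^sup>+x. F x \<partial>lborel)"
  using assms
proof (induction L arbitrary: F)
  case Nil
  then show ?case by (simp add: det_I)
next
  case (Cons e L)
  obtain i k where e: "e = (i, k)" by force
  note [measurable] = Cons.prems(2)
  let ?M = "chain_matrix k0 L" and ?w = "square_vec k - square_vec k0"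
  define y where "y = row_coords ?M ?w"
  have L: "pivot_chain k0 L" and "pivot_step ?M (fst ` set L) i ?w"
    using Cons.prems(1) by (simp_all add: e)
  then have y0: "y $ i \<noteq> 0" by (auto simp: pivot_step_def y_def)
  define T :: "real ^ 'n \<Rightarrow> real ^ 'n" where "T x = x + (y \<bullet> x - x \<bullet> axis i 1) *\<^sub>R axis i 1" for x
  have [measurable]: "T \<in> borel_measurable borel" unfolding T_def by measurable
  have mat: "chain_matrix k0 (e # L) *v b = T (?M *v b)" for b
  proof -
    have "?w \<bullet> b = (transpose ?M *v y) \<bullet> b"
      using transpose_mult_row_coords[OF chain_det_nonzero[OF L], of ?w] by (simp add: y_def)
    also have "\<dots> = y \<bullet> (?M *v b)"
      by (metis dot_lmul_matrix inner_commute transpose_matrix_vector)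
    finally have "?w \<bullet> b = y \<bullet> (?M *v b)" .
    then show ?thesis
      by (auto simp: e row_update_def T_def vec_eq_iff axis_def matrix_vector_mult_def inner_vec_def
          inner_axis if_distrib[of "\<lambda>x. _ * x"] cong: if_cong)
  qed
  have "\<bar>det (chain_matrix k0 (e # L))\<bar> = \<bar>y $ i\<bar> * \<bar>det ?M\<bar>"
    by (simp add: e det_row_update[OF chain_det_nonzero[OF L]] abs_mult y_def)
  then have "ennreal \<bar>det (chain_matrix k0 (e # L))\<bar> * (\<integral>\<^sup>+b. F (chain_matrix k0 (e # L) *v b) \<partial>lborel)
      = ennreal \<bar>y $ i\<bar> * (ennreal \<bar>det ?M\<bar> * (\<integral>\<^sup>+b. F (T (?M *v b)) \<partial>lborel))"
    by (simp add: mat ennreal_mult mult.assoc)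
  also have "ennreal \<bar>det ?M\<bar> * (\<integral>\<^sup>+b. F (T (?M *v b)) \<partial>lborel) = (\<integral>\<^sup>+x. F (T x) \<partial>lborel)"
    by (rule Cons.IH[OF L]) measurable
  also have "ennreal \<bar>y $ i\<bar> * (\<integral>\<^sup>+x. F (T x) \<partial>lborel) = (\<integral>\<^sup>+x. F x \<partial>lborel)"
    using nn_integral_replace_coordinate[OF Cons.prems(2), of "axis i 1" y] y0
    by (simp add: T_def inner_axis)
  finally show ?case .
qed

text \<open>
  The chain matrix maps the admissible \<open>b\<close> into a box with sides \<open>2\<eta>\<close> in the pivot columns and \<open>2\<close>
  elsewhere.  The constants \<open>c k\<close> only translate this box; they will absorb the off-diagonal part of
  the form.
\<close>

lemma chain_volume:
  fixes k0 :: "int ^ 'n" and c :: "int ^ 'n \<Rightarrow> real"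
  assumes L: "pivot_chain k0 L" and "0 \<le> \<eta>"
    and range: "\<And>b i. b \<in> S \<Longrightarrow> 0 \<le> b $ i \<and> b $ i \<le> 2"
    and near: "\<And>b i k. b \<in> S \<Longrightarrow> (i, k) \<in> set L \<Longrightarrow>
      \<bar>(\<Sum>l\<in>UNIV. b $ l * (square_vec k - square_vec k0) $ l) + c k\<bar> \<le> \<eta>"
  shows "emeasure lborel S \<le> ennreal (2 ^ CARD('n) * \<eta> ^ length L / \<bar>det (chain_matrix k0 L)\<bar>)"
proof -
  let ?M = "chain_matrix k0 L" and ?I = "fst ` set L"
  define a where "a i = c (the (map_of L i))" for i
  define lo :: "real ^ 'n" where "lo = (\<chi> i. if i \<in> ?I then - \<eta> - a i else 0)"
  define hi :: "real ^ 'n" where "hi = (\<chi> i. if i \<in> ?I then \<eta> - a i else 2)"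
  have sub: "S \<subseteq> {b. ?M *v b \<in> cbox lo hi}"
  proof
    fix b assume b: "b \<in> S"
    have "lo $ i \<le> (?M *v b) $ i \<and> (?M *v b) $ i \<le> hi $ i" for i
    proof (cases "i \<in> ?I")
      case True
      then obtain k where k: "(i, k) \<in> set L" by force
      then have "map_of L i = Some k"
        using chain_matrix_props(2)[OF L] by (simp add: map_of_eq_Some_iff)
      then have a: "a i = c k" by (simp add: a_def)
      have "(?M *v b) $ i = (\<Sum>l\<in>UNIV. b $ l * (square_vec k - square_vec k0) $ l)"
        using chain_matrix_props(4)[OF L k] by (simp add: matrix_vector_mult_def mult.commute)
      moreover have "\<bar>(\<Sum>l\<in>UNIV. b $ l * (square_vec k - square_vec k0) $ l) + c k\<bar> \<le> \<eta>"
        using near b k by blast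
      ultimately show ?thesis using True unfolding lo_def hi_def by (simp add: a abs_le_iff)
    next
      case False
      then have "(?M *v b) $ i = b $ i"
        using chain_matrix_props(3)[OF L False]
        by (simp add: matrix_vector_mult_def axis_def if_distrib[of "\<lambda>x. x * _"] cong: if_cong)
      then show ?thesis using range[OF b] False by (simp add: lo_def hi_def)
    qed
    then show "b \<in> {b. ?M *v b \<in> cbox lo hi}" by (simp add: mem_box_cart)
  qed
  have ne: "cbox lo hi \<noteq> {}"
    using assms(2) by (auto simp: interval_ne_empty_cart lo_def hi_def)
  have "(\<Prod>i\<in>UNIV. hi $ i - lo $ i) = (\<Prod>i\<in>UNIV. 2 * (if i \<in> ?I then \<eta> else 1))"
    by (intro prod.cong) (auto simp: lo_def hi_def)
  also have "\<dots> = 2 ^ CARD('n) * \<eta> ^ length L"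
    by (simp add: prod.distrib prod.If_cases card_pivots[OF L])
  finally have "measure lborel (cbox lo hi) = 2 ^ CARD('n) * \<eta> ^ length L"
    using content_cbox_cart[OF ne] by simp
  then have content: "emeasure lborel (cbox lo hi) = ennreal (2 ^ CARD('n) * \<eta> ^ length L)"
    using emeasure_eq_ennreal_measure[of lborel "cbox lo hi"] emeasure_lborel_cbox_finite[of lo hi] by simp
  have [measurable]: "(\<lambda>b. ?M *v b) \<in> borel_measurable borel"
    by (intro borel_measurable_continuous_onI continuous_intros)
  have "ennreal \<bar>det ?M\<bar> * emeasure lborel S \<le> ennreal \<bar>det ?M\<bar> * emeasure lborel {b. ?M *v b \<in> cbox lo hi}"
    by (intro mult_left_mono emeasure_mono sub) simp_all
  also have "emeasure lborel {b. ?M *v b \<in> cbox lo hi} = (\<integral>\<^sup>+b. indicator (cbox lo hi) (?M *v b) \<partial>lborel)"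
  proof -
    have "{b. ?M *v b \<in> cbox lo hi} \<in> sets borel"
      using measurable_sets[of "\<lambda>b. ?M *v b" borel borel "cbox lo hi"] by (simp add: vimage_def)
    then have "emeasure lborel {b. ?M *v b \<in> cbox lo hi} = (\<integral>\<^sup>+b. indicator {b. ?M *v b \<in> cbox lo hi} b \<partial>lborel)"
      by simp
    then show ?thesis by (simp add: indicator_def)
  qed
  also have "ennreal \<bar>det ?M\<bar> * \<dots> = emeasure lborel (cbox lo hi)"
    by (subst nn_integral_chain_matrix[OF L]) auto
  finally have "emeasure lborel S * ennreal \<bar>det ?M\<bar> \<le> ennreal (2 ^ CARD('n) * \<eta> ^ length L)"
    by (simp add: content mult.commute)
  moreover have "0 < \<bar>det ?M\<bar>" using chain_det_nonzero[OF L] by simp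
  ultimately have "emeasure lborel S \<le> ennreal (2 ^ CARD('n) * \<eta> ^ length L) / ennreal \<bar>det ?M\<bar>"
    using divide_right_mono_ennreal[of "emeasure lborel S * ennreal \<bar>det ?M\<bar>" _ "ennreal \<bar>det ?M\<bar>"]
    by (simp add: ennreal_mult_divide_eq)
  also have "\<dots> = ennreal (2 ^ CARD('n) * \<eta> ^ length L / \<bar>det ?M\<bar>)"
    using \<open>0 < \<bar>det ?M\<bar>\<close> \<open>0 \<le> \<eta>\<close> by (intro divide_ennreal) auto
  finally show ?thesis .
qed

section \<open>The expected number of chains in a shell\<close>

definition chain_count :: "(int ^ 'n \<Rightarrow> real) \<Rightarrow> nat \<Rightarrow> nat \<Rightarrow> real \<Rightarrow> nat" where
  "chain_count q m r \<eta> =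
     (\<Sum>k0\<in>lattice_box m. card {L \<in> pivot_chains k0 (lattice_box m) r. \<forall>(i, k)\<in>set L. \<bar>q k - q k0\<bar> \<le> \<eta>})"

lemma chain_count_ge:
  fixes S :: "(int ^ 'n) set"
  assumes S: "S \<subseteq> lattice_box m"
    and near: "\<And>k k'. k \<in> S \<Longrightarrow> k' \<in> S \<Longrightarrow> \<bar>q k - q k'\<bar> \<le> \<eta>"
    and large: "2 * 4 ^ CARD('n) * (2 * m + 1) ^ (r - 1) \<le> card S"
  shows "card S * (real (card S) / 2) ^ r \<le> chain_count q m r \<eta>"
proof -
  let ?T = "\<lambda>k0. {L \<in> pivot_chains k0 (lattice_box m) r. \<forall>(i, k)\<in>set L. \<bar>q k - q k0\<bar> \<le> \<eta>}"
  have "card S * (real (card S) / 2) ^ r = (\<Sum>k0\<in>S. (real (card S) / 2) ^ r)" by simp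
  also have "\<dots> \<le> (\<Sum>k0\<in>S. real (card (?T k0)))"
  proof (intro sum_mono)
    fix k0 assume k0: "k0 \<in> S"
    have "pivot_chains k0 S r \<subseteq> ?T k0"
    proof
      fix L assume L: "L \<in> pivot_chains k0 S r"
      then have "k \<in> S" if "(i, k) \<in> set L" for i k
        using that by (force simp: pivot_chains_def)
      then show "L \<in> ?T k0"
        using L S near k0 by (auto simp: pivot_chains_def)
    qed
    then have "card (pivot_chains k0 S r) \<le> card (?T k0)"
      by (intro card_mono) (auto simp: finite_chains)
    have "(real (card S) / 2) ^ r \<le> card (pivot_chains k0 S r)"
      by (rule card_chains_ge[OF S large]) simp
    also have "\<dots> \<le> card (?T k0)" using \<open>card (pivot_chains k0 S r) \<le> card (?T k0)\<close> by simp
    finally show "(real (card S) / 2) ^ r \<le> card (?T k0)" .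
  qed
  also have "\<dots> \<le> (\<Sum>k0\<in>lattice_box m. real (card (?T k0)))"
    by (intro sum_mono2 S) auto
  finally show ?thesis by (simp add: chain_count_def)
qed

text \<open>
  A random function on the lattice whose values along a chain are all close to the value at the base
  point only on a set as small as in \<open>chain_volume\<close>.  Both families of generic tori are instances.
\<close>

locale random_form =
  fixes M :: "'a measure" and A :: "'a set" and Q :: "'a \<Rightarrow> int ^ 'n \<Rightarrow> real" and K :: real
  assumes A_sets: "A \<in> sets M"
    and Q_measurable [measurable]: "\<And>k. (\<lambda>\<omega>. Q \<omega> k) \<in> borel_measurable M"
    and K_nonneg: "0 \<le> K"
    and volume: "\<And>k0 L \<eta>. pivot_chain k0 L \<Longrightarrow> 0 \<le> \<eta> \<Longrightarrow>
      emeasure M {\<omega> \<in> A. \<forall>(i, k)\<in>set L. \<bar>Q \<omega> k - Q \<omega> k0\<bar> \<le> \<eta>}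
        \<le> ennreal (K * \<eta> ^ length L / \<bar>det (chain_matrix k0 L)\<bar>)"
begin

definition chain_event :: "int ^ 'n \<Rightarrow> ('n \<times> (int ^ 'n)) list \<Rightarrow> real \<Rightarrow> 'a set" where
  "chain_event k0 L \<eta> = {\<omega> \<in> A. \<forall>(i, k)\<in>set L. \<bar>Q \<omega> k - Q \<omega> k0\<bar> \<le> \<eta>}"

lemma chain_event_sets [measurable]: "chain_event k0 L \<eta> \<in> sets M"
proof -
  have "chain_event k0 L \<eta> = A \<inter> {\<omega> \<in> space M. \<forall>e\<in>set L. \<bar>Q \<omega> (snd e) - Q \<omega> k0\<bar> \<le> \<eta>}"
    using sets.sets_into_space[OF A_sets] by (auto simp: chain_event_def)
  moreover have "{\<omega> \<in> space M. \<forall>e\<in>set L. \<bar>Q \<omega> (snd e) - Q \<omega> k0\<bar> \<le> \<eta>} \<in> sets M"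
    by measurable
  ultimately show ?thesis using A_sets by auto
qed

lemma chain_count_eq:
  "indicator A \<omega> * ennreal (chain_count (Q \<omega>) m r \<eta>) =
    (\<Sum>k0\<in>lattice_box m. \<Sum>L\<in>pivot_chains k0 (lattice_box m) r. indicator (chain_event k0 L \<eta>) \<omega>)"
proof (cases "\<omega> \<in> A")
  case True
  have "ennreal (real (card {L \<in> pivot_chains k0 (lattice_box m) r. \<forall>(i, k)\<in>set L. \<bar>Q \<omega> k - Q \<omega> k0\<bar> \<le> \<eta>}))
      = (\<Sum>L\<in>pivot_chains k0 (lattice_box m) r. indicator (chain_event k0 L \<eta>) \<omega>)" for k0
  proof -
    have "(\<Sum>L\<in>pivot_chains k0 (lattice_box m) r. indicator (chain_event k0 L \<eta>) \<omega> :: ennreal)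
        = (\<Sum>L\<in>pivot_chains k0 (lattice_box m) r. if \<forall>(i, k)\<in>set L. \<bar>Q \<omega> k - Q \<omega> k0\<bar> \<le> \<eta> then 1 else 0)"
      using True by (intro sum.cong) (auto simp: chain_event_def indicator_def)
    also have "\<dots> = of_nat (card {L \<in> pivot_chains k0 (lattice_box m) r. \<forall>(i, k)\<in>set L. \<bar>Q \<omega> k - Q \<omega> k0\<bar> \<le> \<eta>})"
      by (subst sum.If_cases) (auto simp: finite_chains Int_def)
    finally show ?thesis by (simp add: ennreal_of_nat_eq_real_of_nat)
  qed
  then show ?thesis using True by (simp add: chain_count_def sum_ennreal[symmetric])
qed (simp add: chain_event_def)

lemma chain_count_measurable [measurable]:
  "(\<lambda>\<omega>. indicator A \<omega> * ennreal (chain_count (Q \<omega>) m r \<eta>)) \<in> borel_measurable M"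
  unfolding chain_count_eq by measurable

lemma expected_chain_count:
  assumes "r + 1 \<le> CARD('n)" "0 \<le> \<eta>"
  shows "(\<integral>\<^sup>+\<omega>. indicator A \<omega> * ennreal (chain_count (Q \<omega>) m r \<eta>) \<partial>M)
    \<le> ennreal (K * \<eta> ^ r * real (2 * m + 1) ^ CARD('n) * step_weight TYPE('n) m ^ r)"
proof -
  have "(\<integral>\<^sup>+\<omega>. indicator A \<omega> * ennreal (chain_count (Q \<omega>) m r \<eta>) \<partial>M)
      = (\<Sum>k0\<in>lattice_box m. \<Sum>L\<in>pivot_chains k0 (lattice_box m) r. emeasure M (chain_event k0 L \<eta>))"
    unfolding chain_count_eq by (simp add: nn_integral_sum)
  also have "\<dots> \<le> (\<Sum>k0\<in>(lattice_box m :: (int ^ 'n) set). \<Sum>L\<in>pivot_chains k0 (lattice_box m) r.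
      ennreal (K * \<eta> ^ r * (1 / \<bar>det (chain_matrix k0 L)\<bar>)))"
  proof (intro sum_mono)
    fix k0 :: "int ^ 'n" and L assume "L \<in> pivot_chains k0 (lattice_box m) r"
    then show "emeasure M (chain_event k0 L \<eta>) \<le> ennreal (K * \<eta> ^ r * (1 / \<bar>det (chain_matrix k0 L)\<bar>))"
      using volume[of k0 L \<eta>] assms(2) by (auto simp: pivot_chains_def chain_event_def)
  qed
  also have "\<dots> = ennreal (\<Sum>k0\<in>(lattice_box m :: (int ^ 'n) set). \<Sum>L\<in>pivot_chains k0 (lattice_box m) r.
      K * \<eta> ^ r * (1 / \<bar>det (chain_matrix k0 L)\<bar>))"
    using K_nonneg assms(2) by (simp add: sum_ennreal sum_nonneg)
  also have "\<dots> \<le> ennreal (\<Sum>k0\<in>(lattice_box m :: (int ^ 'n) set). K * \<eta> ^ r * step_weight TYPE('n) m ^ r)"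
    using K_nonneg assms(2)
    by (intro ennreal_leI sum_mono, subst sum_distrib_left[symmetric])
       (intro mult_left_mono sum_chains_le assms(1); simp)
  also have "\<dots> = ennreal (K * \<eta> ^ r * real (2 * m + 1) ^ CARD('n) * step_weight TYPE('n) m ^ r)"
    by (simp add: card_lattice_box mult_ac)
  finally show ?thesis .
qed

end

section \<open>Almost sure bounds on all dyadic scales\<close>

lemma step_weight_le:
  assumes "\<tau> > 0"
  obtains c where "c \<ge> 0"
    "\<And>i. step_weight TYPE('n::finite) (6 * 2 ^ i) \<le> c * (2 ^ i) ^ (CARD('n) - 2) * (2 ^ i) powr (2 * \<tau>)"
proof -
  define c0 where "c0 = 1 + 2 powr \<tau> / \<tau>"
  have c0: "c0 \<ge> 0" using assms by (simp add: c0_def)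
  define c where "c = CARD('n) * 13 ^ (CARD('n) - 2) * (12 * c0 * 6 powr \<tau>)\<^sup>2"
  have "c \<ge> 0" by (simp add: c_def)
  moreover have "step_weight TYPE('n) (6 * 2 ^ i) \<le> c * (2 ^ i) ^ (CARD('n) - 2) * (2 ^ i) powr (2 * \<tau>)" for i
  proof -
    let ?X = "2 ^ i :: real"
    have X: "?X \<ge> 1" by simp
    have "harm (6 * 2 ^ i + 1) \<le> c0 * real (6 * 2 ^ i) powr \<tau>"
      unfolding c0_def by (rule harm_le_powr[OF assms]) simp
    also have "\<dots> = c0 * 6 powr \<tau> * ?X powr \<tau>" by (simp add: powr_mult)
    finally have "12 * harm (6 * 2 ^ i + 1) \<le> 12 * c0 * 6 powr \<tau> * ?X powr \<tau>" by simp
    then have "(12 * harm (6 * 2 ^ i + 1))\<^sup>2 \<le> (12 * c0 * 6 powr \<tau> * ?X powr \<tau>)\<^sup>2"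
      by (intro power_mono) (auto simp: harm_nonneg)
    also have "\<dots> = (12 * c0 * 6 powr \<tau>)\<^sup>2 * ?X powr (2 * \<tau>)"
      by (simp only: power_mult_distrib) (simp add: powr_power mult.commute)
    finally have h: "(12 * harm (6 * 2 ^ i + 1))\<^sup>2 \<le> (12 * c0 * 6 powr \<tau>)\<^sup>2 * ?X powr (2 * \<tau>)" .
    have "real (2 * (6 * 2 ^ i) + 1) \<le> 13 * ?X" using X by simp
    then have "real (2 * (6 * 2 ^ i) + 1) ^ (CARD('n) - 2) \<le> (13 * ?X) ^ (CARD('n) - 2)"
      by (intro power_mono) auto
    then have m: "real ((2 * (6 * 2 ^ i) + 1) ^ (CARD('n) - 2)) \<le> 13 ^ (CARD('n) - 2) * ?X ^ (CARD('n) - 2)"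
      by (simp only: of_nat_power power_mult_distrib)
    have "step_weight TYPE('n) (6 * 2 ^ i) \<le> CARD('n) * (13 ^ (CARD('n) - 2) * ?X ^ (CARD('n) - 2))
        * ((12 * c0 * 6 powr \<tau>)\<^sup>2 * ?X powr (2 * \<tau>))"
      unfolding step_weight_def by (intro mult_mono mult_left_mono m h) auto
    also have "\<dots> = c * ?X ^ (CARD('n) - 2) * ?X powr (2 * \<tau>)"
      by (simp add: c_def mult_ac)
    finally show ?thesis .
  qed
  ultimately show thesis by (rule that)
qed

text \<open>
  In terms of \<open>\<lambda> = 2\<^sup>i\<close> and \<open>\<delta> = 2\<^sup>-\<^sup>j\<close> this is \<open>(\<delta>\<lambda>)\<^sup>r \<lambda>\<^sup>d \<lambda>\<^sup>r\<^sup>(\<^sup>d\<^sup>-\<^sup>2\<^sup>) (\<lambda>/\<delta>)\<^sup>\<epsilon>\<close>.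
\<close>

definition dyadic_bound :: "nat \<Rightarrow> nat \<Rightarrow> real \<Rightarrow> nat \<Rightarrow> nat \<Rightarrow> real" where
  "dyadic_bound d r \<epsilon> i j = (2 ^ i) ^ (d + (d - 1) * r) / (2 ^ j) ^ r * (2 ^ i * 2 ^ j) powr \<epsilon>"

lemma dyadic_bound_pos [simp]: "dyadic_bound d r \<epsilon> i j > 0"
  by (simp add: dyadic_bound_def)

text \<open>
  For \<open>\<lambda> = 2\<^sup>i\<close> and \<open>\<delta> = 2\<^sup>-\<^sup>j\<close> the expected number of chains is smaller than the normalisation
  \<open>dyadic_bound\<close> by a factor that is summable over \<open>i\<close> and \<open>j\<close>: half of the loss \<open>(\<lambda>/\<delta>)\<^sup>\<epsilon>\<close> absorbs the
  logarithms and the other half gives convergence.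
\<close>

lemma expectation_le_dyadic_bound:
  assumes r: "1 \<le> r" "2 \<le> CARD('n::finite)" and "\<epsilon> > 0" "K \<ge> 0"
  obtains C where "C \<ge> 0"
    "\<And>i j. K * (12 * 2 ^ i / 2 ^ j) ^ r * real (2 * (6 * 2 ^ i) + 1) ^ CARD('n) * step_weight TYPE('n) (6 * 2 ^ i) ^ r
      \<le> C * (2 powr (- \<epsilon> / 2)) ^ i * (2 powr (- \<epsilon> / 2)) ^ j * dyadic_bound CARD('n) r \<epsilon> i j"
proof -
  let ?d = "CARD('n)"
  \<comment> \<open>Each of the \<open>r\<close> steps loses \<open>\<lambda>\<close> to the power \<open>2 \<tau>\<close>, in total \<open>\<epsilon> / 2\<close>.\<close>
  define \<tau> where "\<tau> = \<epsilon> / (4 * r)"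
  have "\<tau> > 0" using assms by (simp add: \<tau>_def)
  then obtain c where c: "c \<ge> 0"
    "\<And>i. step_weight TYPE('n) (6 * 2 ^ i) \<le> c * (2 ^ i) ^ (?d - 2) * (2 ^ i) powr (2 * \<tau>)"
    using step_weight_le by blast
  define C where "C = K * 12 ^ r * 13 ^ ?d * c ^ r"
  have C0: "C \<ge> 0" using assms c(1) by (simp add: C_def)
  have "K * (12 * 2 ^ i / 2 ^ j) ^ r * real (2 * (6 * 2 ^ i) + 1) ^ ?d * step_weight TYPE('n) (6 * 2 ^ i) ^ r
      \<le> C * (2 powr (- \<epsilon> / 2)) ^ i * (2 powr (- \<epsilon> / 2)) ^ j * dyadic_bound ?d r \<epsilon> i j" for i j
  proof -
    define X Y :: real where "X = 2 ^ i" and "Y = 2 ^ j"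
    have XY: "X \<ge> 1" "Y \<ge> 1" by (simp_all add: X_def Y_def)
    have sw: "0 \<le> step_weight TYPE('n) (6 * 2 ^ i)" by (simp add: step_weight_def)
    have "real (2 * (6 * 2 ^ i) + 1) \<le> 13 * X" using XY by (simp add: X_def)
    then have "real (2 * (6 * 2 ^ i) + 1) ^ ?d \<le> (13 * X) ^ ?d" by (intro power_mono) auto
    moreover have "step_weight TYPE('n) (6 * 2 ^ i) ^ r \<le> (c * X ^ (?d - 2) * X powr (2 * \<tau>)) ^ r"
      using c(2)[of i] sw by (intro power_mono) (auto simp: X_def)
    ultimately have "K * (12 * X / Y) ^ r * real (2 * (6 * 2 ^ i) + 1) ^ ?d * step_weight TYPE('n) (6 * 2 ^ i) ^ r
        \<le> K * (12 * X / Y) ^ r * (13 * X) ^ ?d * (c * X ^ (?d - 2) * X powr (2 * \<tau>)) ^ r"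
      using sw assms XY by (intro mult_mono mult_left_mono) auto
    also have "\<dots> = C * (X ^ r * X ^ ?d * (X ^ (?d - 2)) ^ r) / Y ^ r * (X powr (2 * \<tau>)) ^ r"
      by (simp add: C_def power_mult_distrib power_divide mult_ac)
    also have "(X powr (2 * \<tau>)) ^ r = X powr (\<epsilon> / 2)"
      using XY r by (simp add: powr_power \<tau>_def)
    also have "X ^ r * X ^ ?d * (X ^ (?d - 2)) ^ r = X ^ (?d + (?d - 1) * r)"
    proof -
      obtain e where e: "?d = e + 2" using r(2) by (metis add.commute le_Suc_ex)
      show ?thesis unfolding e by (simp add: power_mult[symmetric] power_add[symmetric] algebra_simps)
    qed
    also have "C * X ^ (?d + (?d - 1) * r) / Y ^ r * X powr (\<epsilon> / 2)
        \<le> C * X ^ (?d + (?d - 1) * r) / Y ^ r * (X powr (\<epsilon> / 2) * Y powr (\<epsilon> / 2))"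
      using C0 XY assms(3) by (intro mult_left_mono) (auto simp: ge_one_powr_ge_zero)
    also have "X powr (\<epsilon> / 2) * Y powr (\<epsilon> / 2) = X powr (- \<epsilon> / 2) * Y powr (- \<epsilon> / 2) * (X * Y) powr \<epsilon>"
    proof -
      have "X powr (- \<epsilon> / 2) * X powr \<epsilon> = X powr (\<epsilon> / 2)" "Y powr (- \<epsilon> / 2) * Y powr \<epsilon> = Y powr (\<epsilon> / 2)"
        by (simp_all add: powr_add[symmetric])
      then show ?thesis using XY by (simp add: powr_mult mult_ac) (metis mult.assoc mult.commute)
    qed
    also have "X powr (- \<epsilon> / 2) = (2 powr (- \<epsilon> / 2)) ^ i"
      by (simp add: X_def powr_power powr_realpow[symmetric] powr_powr mult.commute)
    also have "Y powr (- \<epsilon> / 2) = (2 powr (- \<epsilon> / 2)) ^ j"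
      by (simp add: Y_def powr_power powr_realpow[symmetric] powr_powr mult.commute)
    finally show ?thesis by (simp add: dyadic_bound_def X_def Y_def mult_ac)
  qed
  with C0 show thesis by (rule that)
qed

lemma ennreal_le_suminf: "f i \<le> (\<Sum>i. f i :: ennreal)"
  using sum_le_suminf[OF summableI, of "{i}" f] by simp

context random_form
begin

text \<open>
  The normalised counts on all dyadic scales have a finite expected sum, so this sum is almost surely
  finite, and it bounds each of its terms.
\<close>

lemma AE_chain_count_le:
  assumes r: "1 \<le> r" "r + 1 \<le> CARD('n)" and \<epsilon>: "\<epsilon> > 0"
  shows "AE \<omega> in M. \<omega> \<in> A \<longrightarrow> (\<exists>C\<ge>0. \<forall>i j.
    chain_count (Q \<omega>) (6 * 2 ^ i) r (12 * 2 ^ i / 2 ^ j) \<le> C * dyadic_bound CARD('n) r \<epsilon> i j)"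
proof -
  define x where "x = (2::real) powr (- \<epsilon> / 2)"
  have "2 powr (- \<epsilon> / 2) < (2::real) powr 0" using \<epsilon> by (intro powr_less_mono) auto
  then have x: "0 \<le> x" "x < 1" by (simp_all add: x_def)
  let ?B = "dyadic_bound CARD('n) r \<epsilon>"
  have d2: "2 \<le> CARD('n)" using r by linarith
  obtain C where C: "C \<ge> 0"
    "\<And>i j. K * (12 * 2 ^ i / 2 ^ j) ^ r * real (2 * (6 * 2 ^ i) + 1) ^ CARD('n) * step_weight TYPE('n) (6 * 2 ^ i) ^ r
      \<le> C * x ^ i * x ^ j * ?B i j"
    using expectation_le_dyadic_bound[OF r(1) d2 \<epsilon> K_nonneg] unfolding x_def by blast
  define T where "T i j \<omega> = indicator A \<omega> * ennreal (chain_count (Q \<omega>) (6 * 2 ^ i) r (12 * 2 ^ i / 2 ^ j))"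
    for i j \<omega>
  define G where "G \<omega> = (\<Sum>i. \<Sum>j. ennreal (1 / ?B i j) * T i j \<omega>)" for \<omega>
  have [measurable]: "T i j \<in> borel_measurable M" for i j
    unfolding T_def by (rule chain_count_measurable)
  have "(\<integral>\<^sup>+\<omega>. G \<omega> \<partial>M) = (\<Sum>i. \<Sum>j. ennreal (1 / ?B i j) * (\<integral>\<^sup>+\<omega>. T i j \<omega> \<partial>M))"
    unfolding G_def by (simp add: nn_integral_suminf nn_integral_cmult)
  also have "\<dots> \<le> (\<Sum>i. \<Sum>j. ennreal (C * x ^ i * x ^ j))"
  proof (intro suminf_le allI summableI)
    fix i j :: nat
    have "(\<integral>\<^sup>+\<omega>. T i j \<omega> \<partial>M) \<le> ennreal (C * x ^ i * x ^ j * ?B i j)"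
      unfolding T_def using C(2)[of i j]
      by (intro order_trans[OF expected_chain_count[OF r(2)]] ennreal_leI) auto
    then have "ennreal (1 / ?B i j) * (\<integral>\<^sup>+\<omega>. T i j \<omega> \<partial>M) \<le> ennreal (1 / ?B i j) * ennreal (C * x ^ i * x ^ j * ?B i j)"
      by (rule mult_left_mono) simp
    also have "\<dots> = ennreal (1 / ?B i j * (C * x ^ i * x ^ j * ?B i j))"
      by (rule ennreal_mult[symmetric]) (use C(1) x in \<open>simp_all add: less_imp_le\<close>)
    also have "1 / ?B i j * (C * x ^ i * x ^ j * ?B i j) = C * x ^ i * x ^ j"
      using dyadic_bound_pos[of "CARD('n)" r \<epsilon> i j] by (simp add: less_imp_neq[symmetric])
    finally show "ennreal (1 / ?B i j) * (\<integral>\<^sup>+\<omega>. T i j \<omega> \<partial>M) \<le> ennreal (C * x ^ i * x ^ j)" .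
  qed
  also have "\<dots> = (\<Sum>i. ennreal (C * x ^ i * (1 / (1 - x))))"
    using C(1) x by (intro suminf_cong suminf_ennreal_eq sums_mult geometric_sums) auto
  also have "\<dots> = ennreal (C * (1 / (1 - x)) * (1 / (1 - x)))"
    using C(1) x by (intro suminf_ennreal_eq sums_mult2 sums_mult geometric_sums) auto
  finally have "(\<integral>\<^sup>+\<omega>. G \<omega> \<partial>M) \<noteq> \<infinity>" by (auto simp: top_unique)
  moreover have "G \<in> borel_measurable M" unfolding G_def by measurable
  ultimately have "AE \<omega> in M. G \<omega> \<noteq> \<infinity>" by (intro nn_integral_PInf_AE)
  then show ?thesis
  proof eventually_elim
    case (elim \<omega>)
    show ?case
    proof (intro impI exI[of _ "enn2real (G \<omega>)"] conjI allI)
      fix i j :: nat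
      assume \<omega>: "\<omega> \<in> A"
      let ?N = "chain_count (Q \<omega>) (6 * 2 ^ i) r (12 * 2 ^ i / 2 ^ j)"
      have "ennreal (1 / ?B i j) * T i j \<omega> \<le> (\<Sum>j. ennreal (1 / ?B i j) * T i j \<omega>)"
        by (rule ennreal_le_suminf)
      also have "\<dots> \<le> G \<omega>"
        unfolding G_def by (rule ennreal_le_suminf[of "\<lambda>i. \<Sum>j. ennreal (1 / ?B i j) * T i j \<omega>"])
      also have "G \<omega> = ennreal (enn2real (G \<omega>))" using elim by (simp add: less_top)
      finally have "ennreal (1 / ?B i j) * ennreal ?N \<le> ennreal (enn2real (G \<omega>))"
        using \<omega> by (simp add: T_def)
      moreover have "ennreal (1 / ?B i j * ?N) = ennreal (1 / ?B i j) * ennreal ?N"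
        by (rule ennreal_mult) (simp_all add: less_imp_le)
      ultimately have "ennreal (1 / ?B i j * ?N) \<le> ennreal (enn2real (G \<omega>))"
        by simp
      then have "1 / ?B i j * ?N \<le> enn2real (G \<omega>)" by simp
      then show "?N \<le> enn2real (G \<omega>) * ?B i j"
        using dyadic_bound_pos[of "CARD('n)" r \<epsilon> i j] by (simp add: field_simps)
    qed simp
  qed
qed

end

section \<open>Lattice points in thin shells\<close>

lemma ex_dyadic:
  fixes x :: real
  assumes "1 \<le> x"
  obtains i where "2 ^ i \<le> x" "x \<le> 2 * 2 ^ i"
proof -
  have "1 \<le> nat \<lfloor>x\<rfloor>" using assms by linarith
  then obtain i where i: "2 ^ i \<le> nat \<lfloor>x\<rfloor>" "nat \<lfloor>x\<rfloor> < 2 ^ (i + 1)"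
    using ex_power_ivl1[of 2 "nat \<lfloor>x\<rfloor>"] by auto
  have x: "real (nat \<lfloor>x\<rfloor>) \<le> x" "x \<le> real (nat \<lfloor>x\<rfloor> + 1)" using assms by linarith+
  have "real (2 ^ i) \<le> real (nat \<lfloor>x\<rfloor>)" using i(1) by (simp only: of_nat_le_iff)
  with x(1) have "real (2 ^ i) \<le> x" by (rule order_trans[rotated])
  then have "2 ^ i \<le> x" by simp
  moreover have "real (nat \<lfloor>x\<rfloor> + 1) \<le> real (2 ^ (i + 1))" unfolding of_nat_le_iff using i(2) by simp
  with x(2) have "x \<le> real (2 ^ (i + 1))" by (rule order_trans)
  then have "x \<le> 2 * 2 ^ i" by simp
  ultimately show thesis by (rule that)
qed

definition shell :: "(int ^ 'n \<Rightarrow> real) \<Rightarrow> real \<Rightarrow> real \<Rightarrow> (int ^ 'n) set" where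
  "shell q lam \<delta> = {k. (\<forall>i. \<bar>of_int (k $ i)\<bar> \<le> 3 * lam) \<and> \<bar>q k - lam\<^sup>2\<bar> \<le> 3 * \<delta> * lam}"

text \<open>
  Comparison of the lower bound \<open>N (N/2)\<^sup>r\<close> for the number of chains in a shell of \<open>N\<close> points with
  the upper bound on the dyadic scale of \<open>\<lambda>\<close> and \<open>\<delta>\<close>; the first term of the bound covers
  the shells with too few points for \<open>chain_count_ge\<close>.
\<close>

lemma card_shell_le:
  fixes q :: "int ^ 'n \<Rightarrow> real"
  assumes r: "1 \<le> r" "r + 1 \<le> CARD('n)" and "\<epsilon> > 0" and C: "C \<ge> 0"
    and count: "\<And>i j. chain_count q (6 * 2 ^ i) r (12 * 2 ^ i / 2 ^ j) \<le> C * dyadic_bound CARD('n) r \<epsilon> i j"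
  obtains C' where "C' \<ge> 0"
    "\<And>lam \<delta>. 1 \<le> lam \<Longrightarrow> 0 < \<delta> \<Longrightarrow> \<delta> < 1 \<Longrightarrow> card (shell q lam \<delta>) \<le>
      C' * (lam ^ (r - 1) + \<delta> * lam ^ (CARD('n) - 1) * (lam / \<delta>) powr (1 / (real r + 1) + \<epsilon>))"
proof -
  let ?d = "CARD('n)"
  define C1 :: real where "C1 = 2 * 4 ^ ?d * 13 ^ (r - 1)"
  define C2 where "C2 = 1 + 4 ^ r * C"
  have C12: "C1 \<ge> 0" "C2 \<ge> 1" using C by (simp_all add: C1_def C2_def)
  have "card (shell q lam \<delta>) \<le>
      (C1 + C2) * (lam ^ (r - 1) + \<delta> * lam ^ (?d - 1) * (lam / \<delta>) powr (1 / (real r + 1) + \<epsilon>))"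
    if lam: "1 \<le> lam" and \<delta>: "0 < \<delta>" "\<delta> < 1" for lam \<delta>
  proof -
    obtain i where i: "2 ^ i \<le> lam" "lam \<le> 2 * 2 ^ i" using ex_dyadic[OF lam] by blast
    have "1 \<le> 1 / \<delta>" using \<delta> by simp
    then obtain j where j: "2 ^ j \<le> 1 / \<delta>" "1 / \<delta> \<le> 2 * 2 ^ j" using ex_dyadic by blast
    have j': "\<delta> \<le> 1 / 2 ^ j" "1 / 2 ^ j \<le> 2 * \<delta>"
      using j \<delta> by (simp_all add: field_simps)
    define S where "S = shell q lam \<delta>"
    \<comment> \<open>As \<open>lam \<le> 2 * 2 ^ i\<close>, the box of radius \<open>3 * lam\<close> is contained in that of radius \<open>?m\<close>.\<close>
    let ?m = "6 * 2 ^ i :: nat"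
    have S: "S \<subseteq> lattice_box ?m"
    proof
      fix k assume k: "k \<in> S"
      have "\<bar>k $ l\<bar> \<le> int ?m" for l
      proof -
        have "real_of_int \<bar>k $ l\<bar> \<le> 3 * lam" using k by (simp add: S_def shell_def)
        also have "\<dots> \<le> real_of_int (int ?m)" using i(2) by simp
        finally show ?thesis by (simp only: of_int_le_iff)
      qed
      then show "k \<in> lattice_box ?m" by (simp add: lattice_box_def)
    qed
    define Z where "Z = \<delta> * lam ^ (?d - 1) * (lam / \<delta>) powr ((1 + \<epsilon>) / (real r + 1))"
    have Z: "Z \<ge> 0" using lam \<delta> by (simp add: Z_def)
    have "Z \<le> \<delta> * lam ^ (?d - 1) * (lam / \<delta>) powr (1 / (real r + 1) + \<epsilon>)"
    proof -
      have "1 \<le> lam / \<delta>" using lam \<delta> by (simp add: field_simps)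
      moreover have "(1 + \<epsilon>) / (real r + 1) \<le> 1 / (real r + 1) + \<epsilon>"
      proof -
        have "\<epsilon> / (real r + 1) \<le> \<epsilon> / 1" using \<open>\<epsilon> > 0\<close> by (intro divide_left_mono) auto
        then show ?thesis by (simp add: add_divide_distrib)
      qed
      ultimately show ?thesis
        unfolding Z_def using lam \<delta> by (intro mult_left_mono powr_mono) auto
    qed
    moreover have "card S \<le> (C1 + C2) * (lam ^ (r - 1) + Z)"
    proof (cases "2 * 4 ^ ?d * (2 * ?m + 1) ^ (r - 1) \<le> card S")
      case False
      have "real (2 * ?m + 1) \<le> 13 * lam" using i lam by simp
      then have pw: "real (2 * ?m + 1) ^ (r - 1) \<le> (13 * lam) ^ (r - 1)" by (intro power_mono) auto
      have "real (card S) \<le> real (2 * 4 ^ ?d * (2 * ?m + 1) ^ (r - 1))"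
        using False by (simp only: of_nat_le_iff)
      also have "\<dots> = 2 * 4 ^ ?d * real (2 * ?m + 1) ^ (r - 1)" by simp
      also have "\<dots> \<le> 2 * 4 ^ ?d * (13 * lam) ^ (r - 1)" using pw by (intro mult_left_mono) auto
      also have "\<dots> = C1 * lam ^ (r - 1)" by (simp add: C1_def power_mult_distrib)
      also have "\<dots> \<le> (C1 + C2) * (lam ^ (r - 1) + Z)"
        using C12 Z lam by (intro mult_mono) auto
      finally show ?thesis .
    next
      case True
      have near: "\<bar>q k - q k'\<bar> \<le> 12 * 2 ^ i / 2 ^ j" if "k \<in> S" "k' \<in> S" for k k'
      proof -
        have "\<bar>q k - lam\<^sup>2\<bar> \<le> 3 * \<delta> * lam" "\<bar>q k' - lam\<^sup>2\<bar> \<le> 3 * \<delta> * lam"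
          using that by (simp_all add: S_def shell_def)
        then have "\<bar>q k - q k'\<bar> \<le> 6 * (\<delta> * lam)" by linarith
        also have "\<dots> \<le> 6 * (1 / 2 ^ j * (2 * 2 ^ i))"
          using i j' lam \<delta> by (intro mult_left_mono mult_mono) auto
        finally show ?thesis by simp
      qed
      have "card S * (real (card S) / 2) ^ r \<le> chain_count q ?m r (12 * 2 ^ i / 2 ^ j)"
        by (rule chain_count_ge[OF S near True])
      also have "\<dots> \<le> C * dyadic_bound ?d r \<epsilon> i j" by (rule count)
      also have "\<dots> \<le> C * (lam ^ (?d + (?d - 1) * r) * (2 * \<delta>) ^ r * (lam / \<delta>) powr \<epsilon>)"
      proof -
        have "dyadic_bound ?d r \<epsilon> i j = (2 ^ i) ^ (?d + (?d - 1) * r) * (1 / 2 ^ j) ^ r * (2 ^ i * 2 ^ j) powr \<epsilon>"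
          by (simp add: dyadic_bound_def power_divide)
        also have "\<dots> \<le> lam ^ (?d + (?d - 1) * r) * (2 * \<delta>) ^ r * (lam * (1 / \<delta>)) powr \<epsilon>"
          using i j j' lam \<delta> \<open>\<epsilon> > 0\<close>
          by (intro mult_mono power_mono powr_mono2) auto
        finally show ?thesis using C by (intro mult_left_mono) auto
      qed
      finally have "card S * (real (card S) / 2) ^ r
          \<le> C * (lam ^ (?d + (?d - 1) * r) * (2 * \<delta>) ^ r * (lam / \<delta>) powr \<epsilon>)" .
      then have "real (card S) ^ (r + 1) \<le> 2 ^ r * (C * (lam ^ (?d + (?d - 1) * r) * (2 * \<delta>) ^ r * (lam / \<delta>) powr \<epsilon>))"
        by (simp add: power_divide field_simps)
      also have "\<dots> = 4 ^ r * C * (lam ^ (?d + (?d - 1) * r) * \<delta> ^ r * (lam / \<delta>) powr \<epsilon>)"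
      proof -
        have "(2 :: real) ^ r * 2 ^ r = 4 ^ r" by (simp add: power_mult_distrib[symmetric])
        then show ?thesis by (simp add: power_mult_distrib mult_ac)
      qed
      also have "lam ^ (?d + (?d - 1) * r) * \<delta> ^ r * (lam / \<delta>) powr \<epsilon> = Z ^ (r + 1)"
      proof -
        have "?d + (?d - 1) * r = Suc ((?d - 1) * (r + 1))"
          using r by (cases "?d") (auto simp: algebra_simps)
        then have "lam ^ (?d + (?d - 1) * r) = lam * (lam ^ (?d - 1)) ^ (r + 1)"
          by (simp only: power_Suc power_mult)
        then have "lam ^ (?d + (?d - 1) * r) * \<delta> ^ r = (lam / \<delta>) * (\<delta> ^ (r + 1) * (lam ^ (?d - 1)) ^ (r + 1))"
          using \<delta> by simp
        moreover have "((lam / \<delta>) powr ((1 + \<epsilon>) / (real r + 1))) ^ (r + 1) = (lam / \<delta>) powr (1 + \<epsilon>)"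
        proof -
          have "real (r + 1) = real r + 1" "real r + 1 \<noteq> 0" by linarith+
          then have "real (r + 1) * ((1 + \<epsilon>) / (real r + 1)) = 1 + \<epsilon>"
            by (simp only: times_divide_eq_right nonzero_mult_div_cancel_left not_False_eq_True)
          moreover have "((lam / \<delta>) powr ((1 + \<epsilon>) / (real r + 1))) ^ (r + 1)
              = (lam / \<delta>) powr (real (r + 1) * ((1 + \<epsilon>) / (real r + 1)))"
            by (rule powr_power) (use lam \<delta> in simp)
          ultimately show ?thesis by (simp only:)
        qed
        moreover have "(lam / \<delta>) powr (1 + \<epsilon>) = (lam / \<delta>) * (lam / \<delta>) powr \<epsilon>"
          using lam \<delta> by (simp add: powr_add)
        ultimately show ?thesis
          unfolding Z_def by (simp only: power_mult_distrib mult_ac)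
      qed
      also have "4 ^ r * C * Z ^ (r + 1) \<le> C2 ^ (r + 1) * Z ^ (r + 1)"
      proof -
        have "4 ^ r * C \<le> C2 ^ 1" by (simp add: C2_def)
        also have "\<dots> \<le> C2 ^ (r + 1)" using C12 by (intro power_increasing) auto
        finally show ?thesis using Z by (intro mult_right_mono) auto
      qed
      finally have "real (card S) ^ Suc r \<le> (C2 * Z) ^ Suc r"
        by (simp only: power_mult_distrib Suc_eq_plus1)
      then have "real (card S) \<le> C2 * Z"
        by (rule power_le_imp_le_base) (use C12 Z in auto)
      also have "\<dots> \<le> (C1 + C2) * (lam ^ (r - 1) + Z)"
        using C12 Z lam by (intro mult_mono) auto
      finally show ?thesis .
    qed
    ultimately show ?thesis
      unfolding S_def using C12 by (elim order_trans) (auto intro!: mult_left_mono)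
  qed
  moreover have "C1 + C2 \<ge> 0" using C12 by simp
  ultimately show thesis using that by blast
qed

context random_form
begin

text \<open>
  A single null set serves all \<open>\<epsilon>\<close>, because the bound weakens as \<open>\<epsilon>\<close> grows and a sequence tending to
  zero suffices.
\<close>

lemma AE_card_shell_le:
  assumes r: "1 \<le> r" "r + 1 \<le> CARD('n)"
  shows "AE \<omega> in M. \<omega> \<in> A \<longrightarrow> (\<forall>\<epsilon>>0. \<exists>C\<ge>0. \<forall>lam \<delta>. 1 \<le> lam \<longrightarrow> 0 < \<delta> \<longrightarrow> \<delta> < 1 \<longrightarrow>
    card (shell (Q \<omega>) lam \<delta>) \<le>
      C * (lam ^ (r - 1) + \<delta> * lam ^ (CARD('n) - 1) * (lam / \<delta>) powr (1 / (real r + 1) + \<epsilon>)))"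
proof -
  have "AE \<omega> in M. \<forall>n. \<omega> \<in> A \<longrightarrow> (\<exists>C\<ge>0. \<forall>i j.
    chain_count (Q \<omega>) (6 * 2 ^ i) r (12 * 2 ^ i / 2 ^ j) \<le> C * dyadic_bound CARD('n) r (1 / real (Suc n)) i j)"
    unfolding AE_all_countable by (intro allI AE_chain_count_le r) simp
  then show ?thesis
  proof eventually_elim
    case (elim \<omega>)
    show ?case
    proof (intro impI allI)
      fix \<epsilon> :: real assume \<omega>: "\<omega> \<in> A" and "\<epsilon> > 0"
      then obtain n where n: "1 / real (Suc n) < \<epsilon>"
        using nat_approx_posE by blast
      obtain C where C: "C \<ge> 0" "\<And>i j. chain_count (Q \<omega>) (6 * 2 ^ i) r (12 * 2 ^ i / 2 ^ j)
          \<le> C * dyadic_bound CARD('n) r (1 / real (Suc n)) i j"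
        using elim \<omega> by blast
      have pos: "0 < 1 / real (Suc n)" by simp
      obtain C' where C': "C' \<ge> 0"
        "\<And>lam \<delta>. 1 \<le> lam \<Longrightarrow> 0 < \<delta> \<Longrightarrow> \<delta> < 1 \<Longrightarrow> card (shell (Q \<omega>) lam \<delta>) \<le>
          C' * (lam ^ (r - 1) + \<delta> * lam ^ (CARD('n) - 1) * (lam / \<delta>) powr (1 / (real r + 1) + 1 / real (Suc n)))"
        using card_shell_le[OF r pos C] by blast
      have "card (shell (Q \<omega>) lam \<delta>) \<le>
          C' * (lam ^ (r - 1) + \<delta> * lam ^ (CARD('n) - 1) * (lam / \<delta>) powr (1 / (real r + 1) + \<epsilon>))"
        if lam: "1 \<le> lam" "0 < \<delta>" "\<delta> < 1" for lam \<delta>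
      proof -
        have "1 \<le> lam / \<delta>" using lam by (simp add: field_simps)
        then have "(lam / \<delta>) powr (1 / (real r + 1) + 1 / real (Suc n)) \<le> (lam / \<delta>) powr (1 / (real r + 1) + \<epsilon>)"
          using n by (intro powr_mono) auto
        then show ?thesis
          using C'(1) lam by (intro order_trans[OF C'(2)[OF lam]] mult_left_mono add_left_mono) auto
      qed
      then show "\<exists>C\<ge>0. \<forall>lam \<delta>. 1 \<le> lam \<longrightarrow> 0 < \<delta> \<longrightarrow> \<delta> < 1 \<longrightarrow> card (shell (Q \<omega>) lam \<delta>) \<le>
          C * (lam ^ (r - 1) + \<delta> * lam ^ (CARD('n) - 1) * (lam / \<delta>) powr (1 / (real r + 1) + \<epsilon>))"
        using C'(1) by blast
    qed
  qed
qed

end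

section \<open>The three regimes of the shell width\<close>

text \<open>
  The three estimates at one pair of parameters, for an abstract relation \<open>P lam \<delta> B\<close> that is read
  as: the quantity under study at \<open>lam\<close> and \<open>\<delta>\<close> is at most \<open>B\<close>.  It is used both for numbers of
  lattice points and for operator norms.
\<close>

definition bounds_at :: "nat \<Rightarrow> (real \<Rightarrow> real \<Rightarrow> real \<Rightarrow> bool) \<Rightarrow> real \<Rightarrow> real \<Rightarrow> real \<Rightarrow> real \<Rightarrow> bool" where
  "bounds_at d P \<epsilon> C lam \<delta> \<longleftrightarrow>
        (\<delta> < lam powr (1 - 2 * real d - \<epsilon>) \<longrightarrow> P lam \<delta> C) \<and>
        (\<forall>a::int. int d \<le> a \<longrightarrow> a \<le> 2 * int d \<longrightarrow>
           lam powr (- real_of_int a) \<le> \<delta> \<longrightarrow> \<delta> \<le> lam powr (1 - real_of_int a) \<longrightarrow>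
           P lam \<delta> (C * \<delta> powr (1 - (real_of_int a + 1) / (real d + real_of_int a + 1))
               * lam powr (real d - 1 + (real_of_int a + 1) / (real d + real_of_int a + 1) + \<epsilon>))) \<and>
        (\<forall>a::int. (real d - 1) / 2 \<le> real_of_int a \<longrightarrow> a < int d \<longrightarrow>
           lam powr (- real_of_int a) \<le> \<delta> \<longrightarrow> \<delta> \<le> lam powr (1 - real_of_int a) \<longrightarrow>
           P lam \<delta> (C * \<delta> powr (1 - 1 / (real d + 1 - real_of_int a))
               * lam powr (real d - 1 + 1 / (real d + 1 - real_of_int a) + \<epsilon>)))"

definition shell_bounds :: "nat \<Rightarrow> (real \<Rightarrow> real \<Rightarrow> real \<Rightarrow> bool) \<Rightarrow> bool" where
  "shell_bounds d P \<longleftrightarrow>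
     (\<forall>\<epsilon>>0. \<exists>C. \<forall>lam \<delta>. 1 \<le> lam \<longrightarrow> 0 < \<delta> \<longrightarrow> \<delta> < 1 \<longrightarrow> bounds_at d P \<epsilon> C lam \<delta>)"

lemma bounds_at_mono:
  assumes P: "bounds_at d P \<epsilon> C lam \<delta>" and mono: "\<And>B. P lam \<delta> B \<Longrightarrow> Q lam \<delta> B"
  shows "bounds_at d Q \<epsilon> C lam \<delta>"
proof -
  note c = P[unfolded bounds_at_def]
  show ?thesis
    unfolding bounds_at_def
    by (intro conjI allI impI; rule mono; rule c[THEN conjunct1, rule_format]
        c[THEN conjunct2, THEN conjunct1, rule_format] c[THEN conjunct2, THEN conjunct2, rule_format]; assumption)
qed

lemma shell_bounds_mono:
  assumes "shell_bounds d P"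
    and "\<And>lam \<delta> B. 1 \<le> lam \<Longrightarrow> 0 < \<delta> \<Longrightarrow> \<delta> < 1 \<Longrightarrow> P lam \<delta> B \<Longrightarrow> Q lam \<delta> B"
  shows "shell_bounds d Q"
  unfolding shell_bounds_def
proof (intro allI impI)
  fix \<epsilon> :: real assume "\<epsilon> > 0"
  then obtain C where "\<And>lam \<delta>. 1 \<le> lam \<Longrightarrow> 0 < \<delta> \<Longrightarrow> \<delta> < 1 \<Longrightarrow> bounds_at d P \<epsilon> C lam \<delta>"
    using assms(1) unfolding shell_bounds_def by blast
  then have "\<And>lam \<delta>. 1 \<le> lam \<Longrightarrow> 0 < \<delta> \<Longrightarrow> \<delta> < 1 \<Longrightarrow> bounds_at d Q \<epsilon> C lam \<delta>"
    by (rule bounds_at_mono) (simp_all add: assms(2))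
  then show "\<exists>C. \<forall>lam \<delta>. 1 \<le> lam \<longrightarrow> 0 < \<delta> \<longrightarrow> \<delta> < 1 \<longrightarrow> bounds_at d Q \<epsilon> C lam \<delta>" by blast
qed

lemma main_term_eq:
  fixes lam \<delta> s :: real and d :: nat
  assumes "1 \<le> lam" "0 < \<delta>" "1 \<le> d"
  shows "\<delta> * lam ^ (d - 1) * (lam / \<delta>) powr s = \<delta> powr (1 - s) * lam powr (real d - 1 + s)"
proof -
  have "lam ^ (d - 1) = lam powr (real d - 1)"
    using assms by (simp add: powr_realpow[symmetric] of_nat_diff)
  moreover have "\<delta> * (lam / \<delta>) powr s = \<delta> powr (1 - s) * lam powr s"
    using assms by (simp add: powr_divide powr_diff)
  ultimately show ?thesis by (simp add: powr_add mult_ac)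
qed

text \<open>
  As \<open>\<lambda>/\<delta> \<le> \<lambda>\<^sup>1\<^sup>+\<^sup>a\<close>, a small power of \<open>\<lambda>/\<delta>\<close> is absorbed by a small power of \<open>\<lambda>\<close>.
\<close>

lemma main_term_le:
  fixes lam \<delta> a e e' \<epsilon> \<epsilon>' :: real and d :: nat
  assumes "1 \<le> lam" "0 < \<delta>" "\<delta> < 1" "lam powr (- a) \<le> \<delta>" "e' \<le> e" "0 \<le> \<epsilon>'" "(1 + a) * \<epsilon>' \<le> \<epsilon>" "1 \<le> d"
  shows "\<delta> * lam ^ (d - 1) * (lam / \<delta>) powr (e' + \<epsilon>') \<le> \<delta> powr (1 - e) * lam powr (real d - 1 + e + \<epsilon>)"
proof -
  have l: "1 \<le> lam / \<delta>" using assms by (simp add: field_simps)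
  have "1 / \<delta> \<le> lam powr a" using assms(1,2,4) by (simp add: powr_minus field_simps)
  then have "lam / \<delta> \<le> lam powr (1 + a)"
    using assms(1,2) by (simp add: powr_add field_simps)
  then have "(lam / \<delta>) powr \<epsilon>' \<le> (lam powr (1 + a)) powr \<epsilon>'"
    using assms by (intro powr_mono2) auto
  also have "\<dots> \<le> lam powr \<epsilon>" using assms by (simp add: powr_powr powr_mono)
  finally have eps: "(lam / \<delta>) powr \<epsilon>' \<le> lam powr \<epsilon>" .
  have "(lam / \<delta>) powr (e' + \<epsilon>') = (lam / \<delta>) powr e' * (lam / \<delta>) powr \<epsilon>'" by (rule powr_add)
  also have "\<dots> \<le> (lam / \<delta>) powr e * lam powr \<epsilon>"
    using l assms by (intro mult_mono eps powr_mono) auto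
  finally have "\<delta> * lam ^ (d - 1) * (lam / \<delta>) powr (e' + \<epsilon>') \<le> \<delta> * lam ^ (d - 1) * ((lam / \<delta>) powr e * lam powr \<epsilon>)"
    using assms by (intro mult_left_mono) auto
  also have "\<dots> = \<delta> powr (1 - e) * lam powr (real d - 1 + e + \<epsilon>)"
    using main_term_eq[OF assms(1,2,8), of e] by (simp add: powr_add mult_ac)
  finally show ?thesis .
qed

text \<open>
  The right-hand side increases with \<open>\<delta>\<close>, so only the left endpoint \<open>\<delta> = \<lambda>\<^sup>-\<^sup>a\<close> matters.
\<close>

lemma power_le_main_term:
  fixes lam \<delta> a e t s :: real
  assumes "1 \<le> lam" "0 < \<delta>" "lam powr (- a) \<le> \<delta>" "e \<le> 1" "t + a * (1 - e) \<le> s"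
  shows "lam powr t \<le> \<delta> powr (1 - e) * lam powr s"
proof -
  have "lam powr t \<le> lam powr (- a * (1 - e)) * lam powr s"
    unfolding powr_add[symmetric] using assms by (intro powr_mono) auto
  also have "lam powr (- a * (1 - e)) = (lam powr (- a)) powr (1 - e)" by (simp add: powr_powr)
  also have "(lam powr (- a)) powr (1 - e) * lam powr s \<le> \<delta> powr (1 - e) * lam powr s"
    using assms by (intro mult_right_mono powr_mono2) auto
  finally show ?thesis .
qed

text \<open>
  The exponents.  For \<open>\<delta> < \<lambda>\<^sup>1\<^sup>-\<^sup>2\<^sup>d\<^sup>-\<^sup>\<epsilon>\<close> both terms of the bound with \<open>r = 1\<close> are at most \<open>1\<close>.  For \<open>a \<ge> d\<close> the
  case \<open>r = 1\<close> is strong enough, since \<open>(a + 1) / (d + a + 1) \<ge> 1/2\<close> and the right-hand side is at least \<open>1\<close>.  For \<open>a < d\<close> take \<open>r = d - a\<close>,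
  which lies between \<open>1\<close> and \<open>d - 1\<close>; the exponent \<open>1 / (r + 1)\<close> is then the required one, and
  \<open>\<lambda>\<^sup>r\<^sup>-\<^sup>1\<close> is dominated by the main term at \<open>\<delta> = \<lambda>\<^sup>-\<^sup>a\<close>.
\<close>

lemma shell_boundsI:
  assumes d: "2 \<le> d"
    and bound: "\<And>r \<epsilon>. 1 \<le> r \<Longrightarrow> r + 1 \<le> d \<Longrightarrow> \<epsilon> > 0 \<Longrightarrow> \<exists>C\<ge>0. \<forall>lam \<delta>. 1 \<le> lam \<longrightarrow> 0 < \<delta> \<longrightarrow> \<delta> < 1 \<longrightarrow>
      N lam \<delta> \<le> C * (lam ^ (r - 1) + \<delta> * lam ^ (d - 1) * (lam / \<delta>) powr (1 / (real r + 1) + \<epsilon>))"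
  shows "shell_bounds d (\<lambda>lam \<delta> B. N lam \<delta> \<le> B)"
  unfolding shell_bounds_def
proof (intro allI impI)
  fix \<epsilon> :: real assume \<epsilon>: "\<epsilon> > 0"
  \<comment> \<open>Chosen so that in the first regime the total exponent of \<open>lam\<close> is exactly zero.\<close>
  define \<epsilon>' where "\<epsilon>' = \<epsilon> / (2 * (2 * d + \<epsilon>))"
  have \<epsilon>': "\<epsilon>' > 0" "\<epsilon>' < 1 / 2" "\<epsilon>' * (2 * d + \<epsilon>) = \<epsilon> / 2"
    using \<epsilon> d by (simp_all add: \<epsilon>'_def field_simps add_pos_pos)
  have "\<forall>r\<in>{1..d - 1}. \<exists>C\<ge>0. \<forall>lam \<delta>. 1 \<le> lam \<longrightarrow> 0 < \<delta> \<longrightarrow> \<delta> < 1 \<longrightarrow>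
      N lam \<delta> \<le> C * (lam ^ (r - 1) + \<delta> * lam ^ (d - 1) * (lam / \<delta>) powr (1 / (real r + 1) + \<epsilon>'))"
    using bound \<epsilon>'(1) d by auto
  from bchoice[OF this] obtain f where f: "\<And>r. r \<in> {1..d - 1} \<Longrightarrow> f r \<ge> 0"
    "\<And>r lam \<delta>. r \<in> {1..d - 1} \<Longrightarrow> 1 \<le> lam \<Longrightarrow> 0 < \<delta> \<Longrightarrow> \<delta> < 1 \<Longrightarrow>
      N lam \<delta> \<le> f r * (lam ^ (r - 1) + \<delta> * lam ^ (d - 1) * (lam / \<delta>) powr (1 / (real r + 1) + \<epsilon>'))"
    by blast
  define C where "C = 2 * (\<Sum>r\<in>{1..d - 1}. f r)"
  have fC: "2 * f r \<le> C" if "r \<in> {1..d - 1}" for r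
    unfolding C_def using that f(1) by (intro mult_left_mono member_le_sum) auto
  have le: "N lam \<delta> \<le> C * Z"
    if "r \<in> {1..d - 1}" "1 \<le> lam" "0 < \<delta>" "\<delta> < 1" "lam ^ (r - 1) \<le> Z"
      "\<delta> * lam ^ (d - 1) * (lam / \<delta>) powr (1 / (real r + 1) + \<epsilon>') \<le> Z" for r lam \<delta> Z
  proof -
    have "N lam \<delta> \<le> f r * (Z + Z)"
      using that f(1) by (intro order_trans[OF f(2)[OF that(1-4)]] mult_left_mono add_mono) auto
    also have "\<dots> = (2 * f r) * Z" by simp
    also have "\<dots> \<le> C * Z"
      using fC[OF that(1)] that by (intro mult_right_mono) (auto intro: order_trans[OF _ that(5)])
    finally show ?thesis .
  qed
  have one: "1 \<in> {1..d - 1}" using d by simp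
  show "\<exists>C. \<forall>lam \<delta>. 1 \<le> lam \<longrightarrow> 0 < \<delta> \<longrightarrow> \<delta> < 1 \<longrightarrow> bounds_at d (\<lambda>lam \<delta> B. N lam \<delta> \<le> B) \<epsilon> C lam \<delta>"
    unfolding bounds_at_def
  proof (rule exI[of _ C], intro allI impI conjI)
    fix lam \<delta> :: real assume lam: "1 \<le> lam" "0 < \<delta>" "\<delta> < 1"
    {
      assume small: "\<delta> < lam powr (1 - 2 * real d - \<epsilon>)"
      have "\<delta> * lam ^ (d - 1) * (lam / \<delta>) powr (1 / (1 + 1) + \<epsilon>') = \<delta> powr (1 / 2 - \<epsilon>') * lam powr (real d - 1 / 2 + \<epsilon>')"
        using main_term_eq[of lam \<delta> d "1 / 2 + \<epsilon>'"] lam d by (simp add: algebra_simps)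
      also have "\<dots> \<le> (lam powr (1 - 2 * real d - \<epsilon>)) powr (1 / 2 - \<epsilon>') * lam powr (real d - 1 / 2 + \<epsilon>')"
        using small lam \<epsilon>' by (intro mult_right_mono powr_mono2) auto
      also have "\<dots> = lam powr ((1 - 2 * real d - \<epsilon>) * (1 / 2 - \<epsilon>') + (real d - 1 / 2 + \<epsilon>'))"
        by (simp add: powr_powr powr_add)
      also have "(1 - 2 * real d - \<epsilon>) * (1 / 2 - \<epsilon>') + (real d - 1 / 2 + \<epsilon>') = \<epsilon>' * (2 * d + \<epsilon>) - \<epsilon> / 2"
        by (simp add: algebra_simps)
      also have "\<dots> = 0" using \<epsilon>'(3) by simp
      finally have "\<delta> * lam ^ (d - 1) * (lam / \<delta>) powr (1 / (1 + 1) + \<epsilon>') \<le> 1" using lam by simp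
      then show "N lam \<delta> \<le> C"
        using le[OF one lam, of 1] by simp
    }
    {
      fix a :: int
      assume a: "int d \<le> a" "a \<le> 2 * int d" "lam powr (- real_of_int a) \<le> \<delta>"
      define e where "e = (real_of_int a + 1) / (real d + real_of_int a + 1)"
      have a': "real d \<le> real_of_int a" "real_of_int a \<le> 2 * real d" using a by linarith+
      have e: "1 / 2 \<le> e" "e \<le> 1" using a' d by (simp_all add: e_def field_simps)
      have "real_of_int a * (1 - e) \<le> real d - 1 + e"
        using a' d by (simp add: e_def field_simps)
      then have "lam powr 0 \<le> \<delta> powr (1 - e) * lam powr (real d - 1 + e + \<epsilon>)"
        using lam a e \<epsilon> by (intro power_le_main_term[of _ _ "real_of_int a"]) auto
      moreover have "(1 + real_of_int a) * \<epsilon>' \<le> \<epsilon>"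
      proof -
        have "(1 + real_of_int a) * \<epsilon>' \<le> (2 * (2 * d + \<epsilon>)) * \<epsilon>'"
          using a' d \<epsilon> \<epsilon>' by (intro mult_right_mono) auto
        also have "\<dots> = \<epsilon>" using \<epsilon>'(3) by (simp add: mult_ac)
        finally show ?thesis .
      qed
      then have "\<delta> * lam ^ (d - 1) * (lam / \<delta>) powr (1 / 2 + \<epsilon>') \<le> \<delta> powr (1 - e) * lam powr (real d - 1 + e + \<epsilon>)"
        using lam a e d \<epsilon>' by (intro main_term_le[where a = "real_of_int a"]) auto
      ultimately have "N lam \<delta> \<le> C * (\<delta> powr (1 - e) * lam powr (real d - 1 + e + \<epsilon>))"
        using lam by (intro le[OF one lam]) auto
      then show "N lam \<delta> \<le> C * \<delta> powr (1 - (real_of_int a + 1) / (real d + real_of_int a + 1))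
          * lam powr (real d - 1 + (real_of_int a + 1) / (real d + real_of_int a + 1) + \<epsilon>)"
        by (simp add: e_def mult.assoc)
    }
    {
      fix a :: int
      assume a: "(real d - 1) / 2 \<le> real_of_int a" "a < int d" "lam powr (- real_of_int a) \<le> \<delta>"
      define r where "r = nat (int d - a)"
      have "0 < (real d - 1) / 2" using d by simp
      then have "0 < real_of_int a" using a(1) by (rule less_le_trans)
      then have "a \<ge> 1" by simp
      then have r: "r \<in> {1..d - 1}" "real_of_int a = real d - real r" using a(2) by (auto simp: r_def)
      define e where "e = 1 / (real r + 1)"
      have e: "e \<le> 1" by (simp add: e_def)
      have rd: "1 \<le> r" "r \<le> d" using r(1) by auto
      have "lam powr real (r - 1) \<le> \<delta> powr (1 - e) * lam powr (real d - 1 + e + \<epsilon>)"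
      proof (rule power_le_main_term[OF lam(1,2) a(3) e])
        have "real (r - 1) = real r - 1" using rd by (simp add: of_nat_diff)
        moreover have "real r - 1 + (real d - real r) * (1 - e) = real d - 1 - (real d - real r) * e"
          by (simp add: algebra_simps)
        moreover have "0 \<le> (real d - real r) * e" "0 \<le> e" using rd by (simp_all add: e_def)
        ultimately show "real (r - 1) + real_of_int a * (1 - e) \<le> real d - 1 + e + \<epsilon>"
          unfolding r(2) using \<epsilon> by linarith
      qed
      then have "lam ^ (r - 1) \<le> \<delta> powr (1 - e) * lam powr (real d - 1 + e + \<epsilon>)"
        using lam by (simp add: powr_realpow)
      moreover have "(1 + real_of_int a) * \<epsilon>' \<le> \<epsilon>"
      proof -
        have "(1 + real_of_int a) * \<epsilon>' \<le> (2 * (2 * d + \<epsilon>)) * \<epsilon>'"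
          using r rd d \<epsilon> \<epsilon>' by (intro mult_right_mono) auto
        also have "\<dots> = \<epsilon>" using \<epsilon>'(3) by (simp add: mult_ac)
        finally show ?thesis .
      qed
      then have "\<delta> * lam ^ (d - 1) * (lam / \<delta>) powr (1 / (real r + 1) + \<epsilon>') \<le> \<delta> powr (1 - e) * lam powr (real d - 1 + e + \<epsilon>)"
        using lam a e d \<epsilon>' by (intro main_term_le[where a = "real_of_int a"]) (auto simp: e_def)
      ultimately have "N lam \<delta> \<le> C * (\<delta> powr (1 - e) * lam powr (real d - 1 + e + \<epsilon>))"
        using lam by (intro le[OF r(1) lam]) auto
      moreover have "1 / (real d + 1 - real_of_int a) = e" by (simp add: r(2) e_def)
      ultimately show "N lam \<delta> \<le> C * \<delta> powr (1 - 1 / (real d + 1 - real_of_int a))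
          * lam powr (real d - 1 + 1 / (real d + 1 - real_of_int a) + \<epsilon>)"
        by (simp only: mult.assoc)
    }
  qed
qed

text \<open>
  In dimension one a bounded quantity satisfies the estimates: the right-hand side of the second is
  at least \<open>C\<close>, and the conditions of the third force \<open>\<delta> \<ge> 1\<close>.
\<close>

lemma shell_bounds_one:
  assumes bound: "\<And>lam \<delta>. 1 \<le> lam \<Longrightarrow> 0 < \<delta> \<Longrightarrow> \<delta> < 1 \<Longrightarrow> N lam \<delta> \<le> C" and "C \<ge> 0"
  shows "shell_bounds 1 (\<lambda>lam \<delta> B. N lam \<delta> \<le> B)"
  unfolding shell_bounds_def bounds_at_def
proof (intro allI impI, rule exI[of _ C], intro allI impI conjI)
  fix \<epsilon> lam \<delta> :: real assume "\<epsilon> > 0" and lam: "1 \<le> lam" "0 < \<delta>" "\<delta> < 1"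
  note le = bound[OF lam]
  show "N lam \<delta> \<le> C" by (rule le)
  {
    fix a :: int
    assume a: "int 1 \<le> a" "a \<le> 2 * int 1" "lam powr (- real_of_int a) \<le> \<delta>"
    define e where "e = (real_of_int a + 1) / (real 1 + real_of_int a + 1)"
    have "e \<le> 1" using a(1) by (simp add: e_def field_simps)
    moreover have "real_of_int a * (1 - e) \<le> real 1 - 1 + e"
      using a(1) by (simp add: e_def field_simps)
    ultimately have "lam powr 0 \<le> \<delta> powr (1 - e) * lam powr (real 1 - 1 + e + \<epsilon>)"
      using lam a \<open>\<epsilon> > 0\<close> by (intro power_le_main_term[of _ _ "real_of_int a"]) auto
    then have "C * 1 \<le> C * (\<delta> powr (1 - e) * lam powr (real 1 - 1 + e + \<epsilon>))"
      using lam \<open>C \<ge> 0\<close> by (intro mult_left_mono) auto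
    then show "N lam \<delta> \<le> C * \<delta> powr (1 - (real_of_int a + 1) / (real 1 + real_of_int a + 1))
          * lam powr (real 1 - 1 + (real_of_int a + 1) / (real 1 + real_of_int a + 1) + \<epsilon>)"
      using le by (simp add: e_def mult.assoc)
  }
  {
    fix a :: int
    assume "(real 1 - 1) / 2 \<le> real_of_int a" "a < int 1" "lam powr (- real_of_int a) \<le> \<delta>"
    then have "1 \<le> \<delta>" using lam by (cases "a = 0") auto
    then show "N lam \<delta> \<le> C * \<delta> powr (1 - 1 / (real 1 + 1 - real_of_int a))
          * lam powr (real 1 - 1 + 1 / (real 1 + 1 - real_of_int a) + \<epsilon>)"
      using lam by simp
  }
qed

section \<open>From lattice points to the spectral projector\<close>

definition lattice_form :: "real ^ 'n ^ 'n \<Rightarrow> int ^ 'n \<Rightarrow> real" where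
  "lattice_form \<beta> k = quad_form \<beta> (\<chi> i. of_int (k $ i))"

definition spectral_points :: "real ^ 'n ^ 'n \<Rightarrow> real \<Rightarrow> real \<Rightarrow> (int ^ 'n) set" where
  "spectral_points \<beta> lam \<delta> = {k. \<bar>sqrt (lattice_form \<beta> k) - lam\<bar> \<le> \<delta>}"

text \<open>
  The constant \<open>1/2\<close> is a common lower bound for all the forms considered here.
\<close>

definition coercive :: "real ^ 'n ^ 'n \<Rightarrow> bool" where
  "coercive \<beta> \<longleftrightarrow> (\<forall>x. 1 / 2 * (\<Sum>i\<in>UNIV. (x $ i)\<^sup>2) \<le> quad_form \<beta> x)"

lemma norm_torus_character [simp]: "norm (torus_character k x) = 1"
  by (simp add: torus_character_def norm_exp_eq_Re)

lemma torus_character_measurable: "torus_character k \<in> borel_measurable torus_measure"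
proof -
  have "continuous_on UNIV (torus_character k)"
    unfolding torus_character_def by (intro continuous_intros)
  then have "torus_character k \<in> borel_measurable lborel"
    by (simp add: borel_measurable_continuous_onI)
  then show ?thesis
    unfolding torus_measure_def by (intro measurable_restrict_space1 measurable_completion)
qed

lemma norm_fourier_coeff_le:
  assumes f: "f \<in> torus_L1" "torus_L1_norm f \<le> 1"
  shows "norm (fourier_coeff f k) \<le> 1"
proof -
  have int: "integrable torus_measure f" using f(1) by (simp add: torus_L1_def)
  have "norm (fourier_coeff f k) \<le> (\<integral>x. norm (f x * torus_character (- k) x) \<partial>torus_measure)"
    unfolding fourier_coeff_def by (rule integral_norm_bound)
  also have "\<dots> = (\<integral>x. norm (f x) \<partial>torus_measure)" by (simp add: norm_mult)
  also have "\<dots> \<le> 1"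
  proof -
    have "ennreal (\<integral>x. norm (f x) \<partial>torus_measure) = torus_L1_norm f"
      unfolding torus_L1_norm_def
      by (rule nn_integral_eq_integral[symmetric]) (use int in auto)
    with f(2) have "ennreal (\<integral>x. norm (f x) \<partial>torus_measure) \<le> ennreal 1" by simp
    then show ?thesis by (subst (asm) ennreal_le_iff) auto
  qed
  finally show ?thesis .
qed

text \<open>
  The Fourier coefficients of a function of \<open>L\<^sup>1\<close> norm at most one are bounded by one, and the
  multiplier vanishes off the shell.
\<close>

lemma L1_Linf_opnorm_le_card:
  fixes \<beta> :: "real ^ 'n ^ 'n"
  assumes cutoff: "is_cutoff cutoff" and "\<delta> > 0" and fin: "finite (spectral_points \<beta> lam \<delta>)"
  shows "L1_Linf_opnorm (spectral_projector cutoff \<beta> lam \<delta>) \<le> ennreal (card (spectral_points \<beta> lam \<delta>))"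
  unfolding L1_Linf_opnorm_def
proof (rule SUP_least)
  fix f :: "real ^ 'n \<Rightarrow> complex"
  assume f: "f \<in> {f \<in> torus_L1. torus_L1_norm f \<le> 1}"
  let ?S = "spectral_points \<beta> lam \<delta>"
  define c where "c k = cutoff ((sqrt (lattice_form \<beta> k) - lam) / \<delta>)" for k
  have c01: "0 \<le> c k" "c k \<le> 1" for k using cutoff by (auto simp: c_def is_cutoff_def)
  have c0: "c k = 0" if "k \<notin> ?S" for k
  proof (rule ccontr)
    let ?t = "(sqrt (lattice_form \<beta> k) - lam) / \<delta>"
    assume "c k \<noteq> 0"
    then have "?t \<in> closure {t. cutoff t \<noteq> 0}"
      using closure_subset[of "{t. cutoff t \<noteq> 0}"] by (auto simp: c_def)
    then have "?t \<in> {-1..1}" using cutoff by (auto simp: is_cutoff_def)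
    then have "\<bar>sqrt (lattice_form \<beta> k) - lam\<bar> \<le> \<delta>"
      using \<open>\<delta> > 0\<close> by (auto simp: abs_le_iff field_simps)
    then show False using that by (simp add: spectral_points_def)
  qed
  have eq: "spectral_projector cutoff \<beta> lam \<delta> f x = (\<Sum>k\<in>?S. of_real (c k) * fourier_coeff f k * torus_character k x)" for x
  proof -
    have "spectral_projector cutoff \<beta> lam \<delta> f x = (\<Sum>\<^sub>\<infinity>k\<in>UNIV. of_real (c k) * fourier_coeff f k * torus_character k x)"
      unfolding spectral_projector_def by (simp add: c_def lattice_form_def)
    also have "\<dots> = (\<Sum>\<^sub>\<infinity>k\<in>?S. of_real (c k) * fourier_coeff f k * torus_character k x)"
      by (rule infsum_cong_neutral) (auto simp: c0)
    finally show ?thesis using fin by simp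
  qed
  have "norm (spectral_projector cutoff \<beta> lam \<delta> f x) \<le> card ?S" for x
  proof -
    have "norm (spectral_projector cutoff \<beta> lam \<delta> f x)
        \<le> (\<Sum>k\<in>?S. norm (of_real (c k) * fourier_coeff f k * torus_character k x))"
      unfolding eq by (rule norm_sum)
    also have "\<dots> \<le> (\<Sum>k\<in>?S. 1 * 1)"
      using c01 f norm_fourier_coeff_le[of f]
      by (intro sum_mono) (simp add: norm_mult mult_le_one del: mult_1)
    finally show ?thesis by simp
  qed
  then have le: "ennreal (norm (spectral_projector cutoff \<beta> lam \<delta> f x)) \<le> ennreal (card ?S)" for x
    by (intro ennreal_leI)
  have "(\<lambda>x. ennreal (norm (spectral_projector cutoff \<beta> lam \<delta> f x))) \<in> borel_measurable torus_measure"
  proof -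
    note [measurable] = torus_character_measurable
    show ?thesis unfolding eq by measurable
  qed
  then show "torus_Linf_norm (spectral_projector cutoff \<beta> lam \<delta> f) \<le> ennreal (card ?S)"
    unfolding torus_Linf_norm_def using le by (intro esssup_I) auto
qed

lemma finite_shell: "finite (shell q lam \<delta> :: (int ^ 'n::finite) set)"
proof (rule finite_subset)
  show "shell q lam \<delta> \<subseteq> lattice_box (nat \<lceil>3 * lam\<rceil>)"
  proof
    fix k assume "k \<in> shell q lam \<delta>"
    then have "\<bar>of_int (k $ i)\<bar> \<le> 3 * lam" for i by (simp add: shell_def)
    then have "\<bar>k $ i\<bar> \<le> int (nat \<lceil>3 * lam\<rceil>)" for i
    proof -
      have "real_of_int \<bar>k $ i\<bar> \<le> 3 * lam" using \<open>\<bar>of_int (k $ i)\<bar> \<le> 3 * lam\<close> by simp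
      then show ?thesis by linarith
    qed
    then show "k \<in> lattice_box (nat \<lceil>3 * lam\<rceil>)" by (simp add: lattice_box_def)
  qed
qed simp

lemma spectral_points_subset_shell:
  fixes \<beta> :: "real ^ 'n ^ 'n"
  assumes \<beta>: "coercive \<beta>" and lam: "1 \<le> lam" "0 < \<delta>" "\<delta> < 1"
  shows "spectral_points \<beta> lam \<delta> \<subseteq> shell (lattice_form \<beta>) lam \<delta>"
proof
  fix k assume k: "k \<in> spectral_points \<beta> lam \<delta>"
  let ?q = "lattice_form \<beta> k"
  have lower: "1 / 2 * (\<Sum>i\<in>UNIV. (of_int (k $ i))\<^sup>2) \<le> ?q"
    using \<beta>[unfolded coercive_def, rule_format, of "\<chi> i. of_int (k $ i)"] by (simp add: lattice_form_def)
  then have "0 \<le> ?q" by (intro order_trans[OF _ lower]) (simp add: sum_nonneg)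
  have s: "\<bar>sqrt ?q - lam\<bar> \<le> \<delta>" using k by (simp add: spectral_points_def)
  have "?q - lam\<^sup>2 = (sqrt ?q - lam) * (sqrt ?q + lam)"
    using \<open>0 \<le> ?q\<close> by (simp add: algebra_simps power2_eq_square)
  then have "\<bar>?q - lam\<^sup>2\<bar> = \<bar>sqrt ?q - lam\<bar> * \<bar>sqrt ?q + lam\<bar>" by (simp add: abs_mult)
  also have "\<dots> \<le> \<delta> * (3 * lam)"
    using s lam \<open>0 \<le> ?q\<close> by (intro mult_mono) auto
  finally have near: "\<bar>?q - lam\<^sup>2\<bar> \<le> 3 * \<delta> * lam" by simp
  have "sqrt ?q \<le> 2 * lam" using s lam by linarith
  then have "?q \<le> (2 * lam)\<^sup>2" using sqrt_le_D by blast
  have "\<bar>of_int (k $ i)\<bar> \<le> 3 * lam" for i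
  proof -
    have "(of_int (k $ i))\<^sup>2 \<le> (\<Sum>i\<in>UNIV. (real_of_int (k $ i))\<^sup>2)"
      by (rule member_le_sum) auto
    also have "\<dots> \<le> 2 * (2 * lam)\<^sup>2" using lower \<open>?q \<le> (2 * lam)\<^sup>2\<close> by linarith
    also have "\<dots> \<le> (3 * lam)\<^sup>2" by (simp add: power2_eq_square)
    finally have "\<bar>real_of_int (k $ i)\<bar> \<le> \<bar>3 * lam\<bar>" by (simp only: abs_le_square_iff)
    then show ?thesis using lam by simp
  qed
  then show "k \<in> shell (lattice_form \<beta>) lam \<delta>" using near by (simp add: shell_def)
qed

text \<open>
  Here \<open>\<surd>Q(k) = \<surd>b \<bar>k\<bar>\<close> with \<open>\<surd>b \<ge> 2/3\<close>, so the absolute values of two points of a shell differ by less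
  than three.
\<close>

lemma card_spectral_points_dim_one:
  fixes \<beta> :: "real ^ 'n ^ 'n"
  assumes \<beta>: "coercive \<beta>" and "CARD('n) = 1" and "\<delta> < 1"
  shows "card (spectral_points \<beta> lam \<delta>) \<le> 10"
proof (cases "spectral_points \<beta> lam \<delta> = {}")
  case False
  then obtain k0 where k0: "k0 \<in> spectral_points \<beta> lam \<delta>" by blast
  obtain i :: 'n where i: "UNIV = {i}" using \<open>CARD('n) = 1\<close> card_1_singletonE by blast
  define b where "b = \<beta> $ i $ i"
  have form: "lattice_form \<beta> k = b * (of_int (k $ i))\<^sup>2" for k
    by (simp add: lattice_form_def quad_form_def i b_def power2_eq_square mult.assoc)
  have "1 / 2 \<le> b"
    using \<beta>[unfolded coercive_def, rule_format, of "\<chi> i. 1"] by (simp add: quad_form_def i b_def)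
  moreover have "(2 / 3)\<^sup>2 \<le> (1 / 2 :: real)" by (simp add: power2_eq_square)
  ultimately have b: "2 / 3 \<le> sqrt b" by (intro real_le_rsqrt) linarith
  have sq: "sqrt (lattice_form \<beta> k) = sqrt b * \<bar>of_int (k $ i)\<bar>" for k
    by (simp add: form real_sqrt_mult)
  let ?I = "{\<bar>k0 $ i\<bar> - 2..\<bar>k0 $ i\<bar> + 2}"
  have "(\<lambda>k. k $ i) ` spectral_points \<beta> lam \<delta> \<subseteq> ?I \<union> uminus ` ?I"
  proof (intro subsetI, elim imageE, simp only:)
    fix k assume k: "k \<in> spectral_points \<beta> lam \<delta>"
    have "\<bar>sqrt b * \<bar>of_int (k $ i)\<bar> - sqrt b * \<bar>of_int (k0 $ i)\<bar>\<bar> < 2"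
      using k k0 \<open>\<delta> < 1\<close> by (simp add: spectral_points_def sq)
    then have "sqrt b * \<bar>\<bar>of_int (k $ i)\<bar> - \<bar>of_int (k0 $ i)\<bar>\<bar> < 2"
      using b by (simp add: abs_mult right_diff_distrib[symmetric])
    moreover have "2 / 3 * \<bar>\<bar>of_int (k $ i)\<bar> - \<bar>of_int (k0 $ i)\<bar>\<bar> \<le> sqrt b * \<bar>\<bar>real_of_int (k $ i)\<bar> - \<bar>of_int (k0 $ i)\<bar>\<bar>"
      using b by (intro mult_right_mono) auto
    ultimately have "\<bar>\<bar>real_of_int (k $ i)\<bar> - \<bar>of_int (k0 $ i)\<bar>\<bar> < 3" by linarith
    then have "\<bar>\<bar>k $ i\<bar> - \<bar>k0 $ i\<bar>\<bar> < 3" by linarith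
    then have "\<bar>k $ i\<bar> \<in> ?I" by auto
    then show "k $ i \<in> ?I \<union> uminus ` ?I"
      by (cases "k $ i \<ge> 0") (auto intro: image_eqI[of _ _ "- (k $ i)"])
  qed
  moreover have "inj_on (\<lambda>k. k $ i) (spectral_points \<beta> lam \<delta>)"
  proof (rule inj_onI)
    fix k k' :: "int ^ 'n" assume "k $ i = k' $ i"
    moreover have "l = i" for l :: 'n using i by blast
    ultimately show "k = k'" by (metis vec_eq_iff)
  qed
  ultimately have "card (spectral_points \<beta> lam \<delta>) \<le> card (?I \<union> uminus ` ?I)"
    by (metis (no_types, lifting) card_image card_mono finite_Un finite_atLeastAtMost_int finite_imageI)
  also have "\<dots> \<le> card ?I + card (uminus ` ?I)" by (rule card_Un_le)
  also have "\<dots> \<le> 10" by (simp add: card_image)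
  finally show ?thesis .
qed simp

lemma shell_bounds_spectral_points:
  fixes \<beta> :: "real ^ 'n ^ 'n"
  assumes \<beta>: "coercive \<beta>"
    and bound: "\<And>r \<epsilon>. 1 \<le> r \<Longrightarrow> r + 1 \<le> CARD('n) \<Longrightarrow> \<epsilon> > 0 \<Longrightarrow>
      \<exists>C\<ge>0. \<forall>lam \<delta>. 1 \<le> lam \<longrightarrow> 0 < \<delta> \<longrightarrow> \<delta> < 1 \<longrightarrow> card (shell (lattice_form \<beta>) lam \<delta>) \<le>
        C * (lam ^ (r - 1) + \<delta> * lam ^ (CARD('n) - 1) * (lam / \<delta>) powr (1 / (real r + 1) + \<epsilon>))"
  shows "shell_bounds CARD('n) (\<lambda>lam \<delta> B. card (spectral_points \<beta> lam \<delta>) \<le> B)"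
proof (cases "CARD('n) = 1")
  case True
  show ?thesis
    unfolding True
    using card_spectral_points_dim_one[OF \<beta> True] by (intro shell_bounds_one[of _ 10]) auto
next
  case False
  then have "2 \<le> CARD('n)" using zero_less_card_finite[where 'a = 'n] by linarith
  then show ?thesis
  proof (rule shell_boundsI)
    fix r :: nat and \<epsilon> :: real assume r: "1 \<le> r" "r + 1 \<le> CARD('n)" "\<epsilon> > 0"
    obtain C where C: "C \<ge> 0" "\<And>lam \<delta>. 1 \<le> lam \<Longrightarrow> 0 < \<delta> \<Longrightarrow> \<delta> < 1 \<Longrightarrow> card (shell (lattice_form \<beta>) lam \<delta>) \<le>
        C * (lam ^ (r - 1) + \<delta> * lam ^ (CARD('n) - 1) * (lam / \<delta>) powr (1 / (real r + 1) + \<epsilon>))"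
      using bound[OF r] by blast
    have "real (card (spectral_points \<beta> lam \<delta>)) \<le>
        C * (lam ^ (r - 1) + \<delta> * lam ^ (CARD('n) - 1) * (lam / \<delta>) powr (1 / (real r + 1) + \<epsilon>))"
      if "1 \<le> lam" "0 < \<delta>" "\<delta> < 1" for lam \<delta>
      using card_mono[OF finite_shell spectral_points_subset_shell[OF \<beta> that]] C(2)[OF that] by linarith
    then show "\<exists>C\<ge>0. \<forall>lam \<delta>. 1 \<le> lam \<longrightarrow> 0 < \<delta> \<longrightarrow> \<delta> < 1 \<longrightarrow> real (card (spectral_points \<beta> lam \<delta>)) \<le>
        C * (lam ^ (r - 1) + \<delta> * lam ^ (CARD('n) - 1) * (lam / \<delta>) powr (1 / (real r + 1) + \<epsilon>))"
      using C(1) by blast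
  qed
qed

context random_form
begin

lemma AE_shell_bounds:
  assumes form: "\<And>\<omega>. \<omega> \<in> A \<Longrightarrow> Q \<omega> = lattice_form (\<beta> \<omega>)" and coercive: "\<And>\<omega>. \<omega> \<in> A \<Longrightarrow> coercive (\<beta> \<omega>)"
  shows "AE \<omega> in M. \<omega> \<in> A \<longrightarrow> shell_bounds CARD('n) (\<lambda>lam \<delta> B. card (spectral_points (\<beta> \<omega>) lam \<delta>) \<le> B)"
proof -
  have "AE \<omega> in M. \<forall>r. 1 \<le> r \<and> r + 1 \<le> CARD('n) \<longrightarrow> \<omega> \<in> A \<longrightarrow>
    (\<forall>\<epsilon>>0. \<exists>C\<ge>0. \<forall>lam \<delta>. 1 \<le> lam \<longrightarrow> 0 < \<delta> \<longrightarrow> \<delta> < 1 \<longrightarrow> card (shell (Q \<omega>) lam \<delta>) \<le>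
      C * (lam ^ (r - 1) + \<delta> * lam ^ (CARD('n) - 1) * (lam / \<delta>) powr (1 / (real r + 1) + \<epsilon>)))"
    unfolding AE_all_countable
  proof (rule allI)
    fix r
    show "AE \<omega> in M. 1 \<le> r \<and> r + 1 \<le> CARD('n) \<longrightarrow> \<omega> \<in> A \<longrightarrow>
      (\<forall>\<epsilon>>0. \<exists>C\<ge>0. \<forall>lam \<delta>. 1 \<le> lam \<longrightarrow> 0 < \<delta> \<longrightarrow> \<delta> < 1 \<longrightarrow> card (shell (Q \<omega>) lam \<delta>) \<le>
        C * (lam ^ (r - 1) + \<delta> * lam ^ (CARD('n) - 1) * (lam / \<delta>) powr (1 / (real r + 1) + \<epsilon>)))"
    proof (cases "1 \<le> r \<and> r + 1 \<le> CARD('n)")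
      case True
      then show ?thesis using AE_card_shell_le[of r] by simp
    qed (rule AE_I2, blast)
  qed
  then show ?thesis
  proof eventually_elim
    case (elim \<omega>)
    show ?case
    proof
      assume \<omega>: "\<omega> \<in> A"
      show "shell_bounds CARD('n) (\<lambda>lam \<delta> B. card (spectral_points (\<beta> \<omega>) lam \<delta>) \<le> B)"
        using elim \<omega> form[OF \<omega>] by (intro shell_bounds_spectral_points coercive) auto
    qed
  qed
qed

end

section \<open>Generic tori\<close>

lemma quad_form_diagonal: "quad_form (\<chi> i j. if i = j then b $ i else 0) x = (\<Sum>i\<in>UNIV. b $ i * (x $ i)\<^sup>2)"
  by (simp add: quad_form_def if_distrib[of "\<lambda>u. u * _"] power2_eq_square mult.assoc cong: if_cong)

lemma coercive_diagonal:
  assumes "b \<in> cbox 1 2"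
  shows "coercive (\<chi> i j. if i = j then b $ i else 0)"
  unfolding coercive_def quad_form_diagonal sum_distrib_left
proof (intro allI sum_mono)
  fix x :: "real ^ 'a" and i
  have "1 \<le> b $ i" using assms by (simp add: mem_box_cart)
  then show "1 / 2 * (x $ i)\<^sup>2 \<le> b $ i * (x $ i)\<^sup>2" by (intro mult_right_mono) auto
qed

lemma AE_rectangular_shell_bounds:
  "AE b in (lborel :: (real ^ 'n) measure). b \<in> cbox 1 2 \<longrightarrow>
    shell_bounds CARD('n) (\<lambda>lam \<delta> B. card (spectral_points (\<chi> i j. if i = j then b $ i else 0) lam \<delta>) \<le> B)"
proof -
  define \<beta> where "\<beta> b = (\<chi> i j. if i = j then b $ i else 0)" for b :: "real ^ 'n"
  have form: "lattice_form (\<beta> b) k = (\<Sum>i\<in>UNIV. b $ i * square_vec k $ i)" for b k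
    by (simp add: lattice_form_def \<beta>_def quad_form_diagonal)
  interpret random_form "lborel :: (real ^ 'n) measure" "cbox 1 2" "\<lambda>b. lattice_form (\<beta> b)" "2 ^ CARD('n)"
  proof
    show "(\<lambda>b. lattice_form (\<beta> b) k) \<in> borel_measurable lborel" for k
    proof -
      have "continuous_on UNIV (\<lambda>b. lattice_form (\<beta> b) k)" unfolding form by (intro continuous_intros)
      then show ?thesis by (simp add: borel_measurable_continuous_onI)
    qed
    fix k0 :: "int ^ 'n" and L and \<eta> :: real
    assume L: "pivot_chain k0 L" "0 \<le> \<eta>"
    show "emeasure lborel {b \<in> cbox 1 2. \<forall>(i, k)\<in>set L. \<bar>lattice_form (\<beta> b) k - lattice_form (\<beta> b) k0\<bar> \<le> \<eta>}
      \<le> ennreal (2 ^ CARD('n) * \<eta> ^ length L / \<bar>det (chain_matrix k0 L)\<bar>)" (is "emeasure _ ?S \<le> _")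
    proof (rule chain_volume[OF L, where c = "\<lambda>_. 0"])
      fix b i assume "b \<in> ?S"
      then have "1 \<le> b $ i" "b $ i \<le> 2" by (simp_all add: mem_box_cart)
      then show "0 \<le> b $ i \<and> b $ i \<le> 2" by simp
    next
      fix b i k assume "b \<in> ?S" "(i, k) \<in> set L"
      then have "\<bar>lattice_form (\<beta> b) k - lattice_form (\<beta> b) k0\<bar> \<le> \<eta>" by blast
      then show "\<bar>(\<Sum>l\<in>UNIV. b $ l * (square_vec k - square_vec k0) $ l) + 0\<bar> \<le> \<eta>"
        by (simp add: form sum_subtractf right_diff_distrib)
    qed
  qed auto
  show ?thesis unfolding \<beta>_def[symmetric]
  proof (rule AE_shell_bounds)
    fix b :: "real ^ 'n" assume b: "b \<in> cbox 1 2"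
    show "coercive (\<beta> b)" unfolding \<beta>_def by (rule coercive_diagonal[OF b])
  qed simp
qed

definition perturbed_identity :: "('n set \<Rightarrow> real) \<Rightarrow> real ^ 'n ^ 'n" where
  "perturbed_identity h = (\<chi> i j. (if i = j then 1 else 0) + h {i, j})"

definition off_diagonal_form :: "('n set \<Rightarrow> real) \<Rightarrow> int ^ 'n \<Rightarrow> real" where
  "off_diagonal_form h k = (\<Sum>i\<in>UNIV. \<Sum>j\<in>UNIV. if i = j then 0 else h {i, j} * of_int (k $ i) * of_int (k $ j))"

lemma lattice_form_perturbed_identity:
  "lattice_form (perturbed_identity h) k =
    (\<Sum>i\<in>UNIV. (1 + h {i}) * square_vec k $ i) + off_diagonal_form h k"
proof -
  have "lattice_form (perturbed_identity h) k =
      (\<Sum>i\<in>UNIV. \<Sum>j\<in>UNIV. (if i = j then (1 + h {i}) * (of_int (k $ i))\<^sup>2 else 0) +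
        (if i = j then 0 else h {i, j} * of_int (k $ i) * of_int (k $ j)))"
    unfolding lattice_form_def quad_form_def perturbed_identity_def
    by (intro sum.cong) (auto simp: power2_eq_square mult.assoc)
  also have "\<dots> = (\<Sum>i\<in>UNIV. (1 + h {i}) * square_vec k $ i) + off_diagonal_form h k"
    by (simp add: sum.distrib off_diagonal_form_def)
  finally show ?thesis .
qed

text \<open>
  By \<open>2 \<bar>x\<^sub>i x\<^sub>j\<bar> \<le> x\<^sub>i\<^sup>2 + x\<^sub>j\<^sup>2\<close> the perturbation changes the form by at most \<open>1 / (10 d)\<close> times the squared
  Euclidean norm.
\<close>

lemma coercive_perturbed_identity:
  fixes h :: "'n::finite set \<Rightarrow> real"
  assumes h: "\<And>p. p \<in> index_pairs \<Longrightarrow> \<bar>h p\<bar> \<le> 1 / (10 * real CARD('n) ^ 2)"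
  shows "coercive (perturbed_identity h)"
  unfolding coercive_def
proof
  fix x :: "real ^ 'n"
  let ?d = "real CARD('n)"
  let ?s = "\<Sum>i\<in>UNIV. (x $ i)\<^sup>2"
  let ?e = "1 / (10 * ?d ^ 2)"
  have d: "1 \<le> ?d" by (simp add: Suc_leI)
  have eq: "quad_form (perturbed_identity h) x = ?s + (\<Sum>i\<in>UNIV. \<Sum>j\<in>UNIV. h {i, j} * x $ i * x $ j)"
  proof -
    have "quad_form (perturbed_identity h) x =
        (\<Sum>i\<in>UNIV. \<Sum>j\<in>UNIV. (if i = j then (x $ i)\<^sup>2 else 0) + h {i, j} * x $ i * x $ j)"
      unfolding quad_form_def perturbed_identity_def
      by (intro sum.cong) (auto simp: power2_eq_square algebra_simps)
    then show ?thesis by (simp add: sum.distrib)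
  qed
  have term_le: "- (h {i, j} * x $ i * x $ j) \<le> ?e / 2 * ((x $ i)\<^sup>2 + (x $ j)\<^sup>2)" for i j
  proof -
    have "- (h {i, j} * x $ i * x $ j) \<le> \<bar>h {i, j}\<bar> * \<bar>x $ i * x $ j\<bar>"
      by (simp add: abs_mult[symmetric] mult.assoc)
    also have "\<dots> \<le> ?e * (((x $ i)\<^sup>2 + (x $ j)\<^sup>2) / 2)"
    proof (rule mult_mono)
      show "\<bar>h {i, j}\<bar> \<le> ?e" by (rule h) (auto simp: index_pairs_def)
      have "0 \<le> (\<bar>x $ i\<bar> - \<bar>x $ j\<bar>)\<^sup>2" by simp
      then show "\<bar>x $ i * x $ j\<bar> \<le> ((x $ i)\<^sup>2 + (x $ j)\<^sup>2) / 2"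
        by (simp add: power2_diff abs_mult)
    qed auto
    finally show ?thesis by simp
  qed
  have "- (\<Sum>i\<in>UNIV. \<Sum>j\<in>UNIV. h {i, j} * x $ i * x $ j)
      \<le> (\<Sum>i\<in>(UNIV :: 'n set). \<Sum>j\<in>(UNIV :: 'n set). ?e / 2 * ((x $ i)\<^sup>2 + (x $ j)\<^sup>2))"
    unfolding sum_negf[symmetric] by (intro sum_mono term_le)
  also have "\<dots> = ?e / 2 * (?d * ?s + ?d * ?s)"
    by (simp only: sum_distrib_left[symmetric] sum.distrib sum_constant)
  also have "\<dots> = ?s * (1 / (10 * ?d))"
    using d by (simp add: field_simps power2_eq_square)
  also have "\<dots> \<le> ?s * (1 / 2)"
  proof (rule mult_left_mono)
    have "1 / (10 * ?d) \<le> 1 / (2 * 1)" using d by (intro divide_left_mono mult_mono) auto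
    then show "1 / (10 * ?d) \<le> 1 / 2" by simp
  qed (simp add: sum_nonneg)
  finally show "1 / 2 * ?s \<le> quad_form (perturbed_identity h) x"
    unfolding eq by linarith
qed

abbreviation singletons :: "'n set set" where
  "singletons \<equiv> range (\<lambda>i. {i})"

lemma measurable_singletons:
  "(\<lambda>g. \<chi> i. 1 + g {i}) \<in> borel_measurable (Pi\<^sub>M (singletons :: 'n::finite set set) (\<lambda>_. lborel :: real measure))"
  unfolding borel_measurable_euclidean_space[of "\<lambda>g. \<chi> i. 1 + g {i}"]
proof
  fix b :: "real ^ 'n" assume "b \<in> Basis"
  then obtain j where b: "b = axis j 1" by (auto simp: Basis_vec_def)
  have "(\<lambda>g. g {j}) \<in> borel_measurable (Pi\<^sub>M singletons (\<lambda>_. lborel :: real measure))"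
    using measurable_component_singleton[of "{j}" singletons "\<lambda>_. lborel :: real measure"] by simp
  then show "(\<lambda>g. (\<chi> i. 1 + g {i}) \<bullet> b) \<in> borel_measurable (Pi\<^sub>M singletons (\<lambda>_. lborel :: real measure))"
    by (simp add: b inner_axis)
qed

text \<open>
  The diagonal entries \<open>1 + h\<^sub>i\<^sub>i\<close>, whose index pairs are the singletons, form a vector distributed
  according to Lebesgue measure.
\<close>

lemma distr_singletons:
  "distr (Pi\<^sub>M (singletons :: 'n::finite set set) (\<lambda>_. lborel)) borel (\<lambda>g. \<chi> i. 1 + g {i}) = (lborel :: (real ^ 'n) measure)"
    (is "distr ?P borel ?b = _")
proof (rule lborel_eqI[symmetric])
  interpret product_sigma_finite "\<lambda>_ :: 'n set. lborel :: real measure" ..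
  have b [measurable]: "?b \<in> borel_measurable ?P" by (rule measurable_singletons)
  fix l u :: "real ^ 'n" assume le: "\<And>b. b \<in> Basis \<Longrightarrow> l \<bullet> b \<le> u \<bullet> b"
  have le': "l $ i \<le> u $ i" for i using le[of "axis i 1"] by (simp add: inner_axis axis_in_Basis_iff)
  define J where "J p = {l $ the_elem p - 1<..<u $ the_elem p - 1}" for p
  have "emeasure (distr ?P borel ?b) (box l u) = emeasure ?P (?b -` box l u \<inter> space ?P)"
    by (rule emeasure_distr) auto
  also have "?b -` box l u \<inter> space ?P = (\<Pi>\<^sub>E p\<in>singletons. J p)"
    by (auto simp: space_PiM mem_box_cart J_def PiE_iff algebra_simps)
  also have "emeasure ?P (\<Pi>\<^sub>E p\<in>singletons. J p) = (\<Prod>p\<in>singletons. emeasure lborel (J p))"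
    by (rule emeasure_PiM) (auto simp: J_def)
  also have "\<dots> = (\<Prod>i\<in>UNIV. ennreal (u $ i - l $ i))"
    using le' by (subst prod.reindex) (auto simp: J_def inj_on_def)
  also have "\<dots> = ennreal (\<Prod>i\<in>UNIV. u $ i - l $ i)" using le' by (intro prod_ennreal) simp
  also have "(\<Prod>i\<in>UNIV. u $ i - l $ i) = (\<Prod>b\<in>Basis. (u - l) \<bullet> b)"
  proof -
    have "(\<Prod>b\<in>Basis. (u - l) \<bullet> b) = (\<Prod>b\<in>(\<lambda>i. axis i 1) ` UNIV. (u - l) \<bullet> b)"
      by (intro prod.cong) (auto simp: Basis_vec_def)
    also have "\<dots> = (\<Prod>i\<in>UNIV. u $ i - l $ i)"
      by (subst prod.reindex) (auto simp: inj_on_def axis_eq_axis inner_axis)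
    finally show ?thesis by simp
  qed
  finally show "emeasure (distr ?P borel ?b) (box l u) = (\<Prod>b\<in>Basis. (u - l) \<bullet> b)" .
qed simp

text \<open>
  By Fubini's theorem it suffices to bound the volume of the diagonals for fixed off-diagonal entries.
  These enter only through the constants in \<open>chain_volume\<close>, and they range over a cube of volume at
  most one.
\<close>

lemma AE_perturbed_shell_bounds:
  "AE h in Pi\<^sub>M (index_pairs :: 'n::finite set set) (\<lambda>_. lborel :: real measure).
    (\<forall>p\<in>index_pairs. \<bar>h p\<bar> \<le> 1 / (10 * real CARD('n) ^ 2)) \<longrightarrow>
    shell_bounds CARD('n) (\<lambda>lam \<delta> B. card (spectral_points (perturbed_identity h) lam \<delta>) \<le> B)"
proof -
  let ?e = "1 / (10 * real CARD('n) ^ 2)"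
  let ?M = "Pi\<^sub>M (index_pairs :: 'n set set) (\<lambda>_. lborel :: real measure)"
  define off where "off = index_pairs - (singletons :: 'n set set)"
  have pairs: "index_pairs = off \<union> singletons" "off \<inter> singletons = {}"
    by (auto simp: off_def index_pairs_def)
  have off_mem: "{i, j} \<in> off" "{i, j} \<notin> singletons" if "i \<noteq> j" for i j
    using that by (auto simp: off_def index_pairs_def)
  have e: "?e \<le> 1 / 10"
  proof -
    have "1 \<le> real CARD('n) ^ 2" by (intro one_le_power) (simp add: Suc_leI)
    then have "1 / (10 * real CARD('n) ^ 2) \<le> 1 / (10 * 1)" by (intro divide_left_mono mult_left_mono) auto
    then show ?thesis by simp
  qed
  define A where "A = {h \<in> space ?M. \<forall>p\<in>index_pairs. \<bar>h p\<bar> \<le> ?e}"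
  define b :: "('n set \<Rightarrow> real) \<Rightarrow> real ^ 'n" where "b g = (\<chi> i. 1 + g {i})" for g
  have A: "A \<in> sets ?M" unfolding A_def by measurable
  have meas: "(\<lambda>h. lattice_form (perturbed_identity h) k) \<in> borel_measurable ?M" for k
  proof -
    have [measurable]: "(\<lambda>h. h {i, j}) \<in> borel_measurable ?M" for i j
    proof -
      have "{i, j} \<in> index_pairs" by (auto simp: index_pairs_def)
      from measurable_component_singleton[OF this, of "\<lambda>_. lborel :: real measure"] show ?thesis by simp
    qed
    show ?thesis unfolding lattice_form_def quad_form_def perturbed_identity_def by simp
  qed
  interpret random_form ?M A "\<lambda>h. lattice_form (perturbed_identity h)" "2 ^ CARD('n)"
  proof
    interpret P: product_sigma_finite "\<lambda>_ :: 'n set. lborel :: real measure" ..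
    fix k0 :: "int ^ 'n" and L and \<eta> :: real
    assume L: "pivot_chain k0 L" "0 \<le> \<eta>"
    let ?V = "ennreal (2 ^ CARD('n) * \<eta> ^ length L / \<bar>det (chain_matrix k0 L)\<bar>)"
    let ?E = "{h \<in> A. \<forall>(i, k)\<in>set L. \<bar>lattice_form (perturbed_identity h) k - lattice_form (perturbed_identity h) k0\<bar> \<le> \<eta>}"
    define cube where "cube = (\<Pi>\<^sub>E p\<in>off. {- ?e..?e})"
    show "emeasure ?M ?E \<le> ?V"
    \<comment> \<open>A set that is not measurable has measure zero by convention.\<close>
    proof (cases "?E \<in> sets ?M")
      case True
      have inner: "(\<integral>\<^sup>+g. indicator ?E (merge off singletons (h, g)) \<partial>Pi\<^sub>M singletons (\<lambda>_. lborel)) \<le> ?V * indicator cube h"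
        if h: "h \<in> space (Pi\<^sub>M off (\<lambda>_. lborel))" for h
      proof (cases "h \<in> cube")
        case False
        have "merge off singletons (h, g) \<notin> ?E" for g
        proof
          assume "merge off singletons (h, g) \<in> ?E"
          then have "\<bar>merge off singletons (h, g) p\<bar> \<le> ?e" if "p \<in> off" for p
          proof -
            have "p \<in> index_pairs" using that by (simp add: off_def)
            then show ?thesis using \<open>merge off singletons (h, g) \<in> ?E\<close> by (simp add: A_def)
          qed
          then have "\<bar>h p\<bar> \<le> ?e" if "p \<in> off" for p
            using that by (auto simp: merge_def)
          then have "h \<in> cube"
            using h by (auto simp: cube_def space_PiM PiE_iff abs_le_iff minus_le_iff)
          with False show False by simp
        qed
        then show ?thesis by simp
      next
        case hc: True
        define S where "S = {b. (\<forall>i. 0 \<le> b $ i \<and> b $ i \<le> 2) \<and>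
          (\<forall>e\<in>set L. \<bar>(\<Sum>l\<in>UNIV. b $ l * (square_vec (snd e) - square_vec k0) $ l)
            + (off_diagonal_form h (snd e) - off_diagonal_form h k0)\<bar> \<le> \<eta>)}"
        have "closed S"
          unfolding S_def Ball_def by (intro closed_Collect_conj closed_Collect_all closed_Collect_imp open_Collect_const closed_Collect_le continuous_intros)
        then have S: "S \<in> sets borel" by (rule borel_closed)
        have b [measurable]: "b \<in> borel_measurable (Pi\<^sub>M singletons (\<lambda>_. lborel))"
          unfolding b_def by (rule measurable_singletons)
        have "b g \<in> S" if g: "merge off singletons (h, g) \<in> ?E" for g
        proof -
          let ?h = "merge off singletons (h, g)"
          have diag: "?h {i} = g {i}" for i using pairs(2) by (auto simp: merge_def)
          have offd: "off_diagonal_form ?h k = off_diagonal_form h k" for k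
            unfolding off_diagonal_form_def
            by (intro sum.cong) (auto simp: merge_def off_mem)
          have "\<bar>g {i}\<bar> \<le> ?e" for i
          proof -
            have "{i} \<in> index_pairs" by (auto simp: index_pairs_def)
            then have "\<bar>?h {i}\<bar> \<le> ?e" using g by (simp add: A_def)
            then show ?thesis by (simp only: diag)
          qed
          moreover have "?e \<le> 1" using e by linarith
          ultimately have "\<bar>g {i}\<bar> \<le> 1" for i by (meson order_trans)
          then have "0 \<le> b g $ i \<and> b g $ i \<le> 2" for i
            by (simp add: b_def abs_le_iff) (smt (verit))
          moreover have "\<bar>(\<Sum>l\<in>UNIV. b g $ l * (square_vec k - square_vec k0) $ l)
            + (off_diagonal_form h k - off_diagonal_form h k0)\<bar> \<le> \<eta>" if "(i, k) \<in> set L" for i k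
          proof -
            have "\<bar>lattice_form (perturbed_identity ?h) k - lattice_form (perturbed_identity ?h) k0\<bar> \<le> \<eta>"
              using g that by blast
            moreover have "lattice_form (perturbed_identity ?h) k - lattice_form (perturbed_identity ?h) k0
              = (\<Sum>l\<in>UNIV. b g $ l * (square_vec k - square_vec k0) $ l)
                + (off_diagonal_form h k - off_diagonal_form h k0)"
              unfolding lattice_form_perturbed_identity offd diag
              by (simp add: b_def sum_subtractf right_diff_distrib)
            ultimately show ?thesis by simp
          qed
          ultimately show ?thesis by (auto simp: S_def)
        qed
        then have "indicator ?E (merge off singletons (h, g)) \<le> (indicator S (b g) :: ennreal)" for g
          by (auto simp: indicator_def)
        then have "(\<integral>\<^sup>+g. indicator ?E (merge off singletons (h, g)) \<partial>Pi\<^sub>M singletons (\<lambda>_. lborel))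
            \<le> (\<integral>\<^sup>+g. indicator S (b g) \<partial>Pi\<^sub>M singletons (\<lambda>_. lborel))"
          by (intro nn_integral_mono)
        also have "\<dots> = (\<integral>\<^sup>+x. indicator S x \<partial>lborel)"
          using S unfolding b_def distr_singletons[symmetric]
          by (subst nn_integral_distr) (auto simp: measurable_singletons)
        also have "\<dots> = emeasure lborel S" using S by simp
        also have "\<dots> \<le> ?V"
          by (rule chain_volume[OF L, where c = "\<lambda>k. off_diagonal_form h k - off_diagonal_form h k0"])
             (force simp: S_def)+
        finally show ?thesis using hc by simp
      qed
      have cube: "emeasure (Pi\<^sub>M off (\<lambda>_. lborel)) cube \<le> 1"
      proof -
        have "emeasure (Pi\<^sub>M off (\<lambda>_. lborel)) cube = (\<Prod>p\<in>off. emeasure lborel {- ?e..?e})"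
          unfolding cube_def by (rule P.emeasure_PiM) auto
        also have "\<dots> = ennreal (2 * ?e) ^ card off" by simp
        also have "\<dots> \<le> 1"
        proof (rule power_le_one)
          have "2 * ?e \<le> 1" using e by linarith
          then show "ennreal (2 * ?e) \<le> 1" by (simp only: ennreal_le_1)
        qed simp
        finally show ?thesis .
      qed
      have "emeasure ?M ?E = (\<integral>\<^sup>+h. indicator ?E h \<partial>Pi\<^sub>M (off \<union> singletons) (\<lambda>_. lborel))"
        using True by (simp add: pairs(1)[symmetric])
      also have "\<dots> = (\<integral>\<^sup>+h. (\<integral>\<^sup>+g. indicator ?E (merge off singletons (h, g)) \<partial>Pi\<^sub>M singletons (\<lambda>_. lborel)) \<partial>Pi\<^sub>M off (\<lambda>_. lborel))"
        using True by (intro P.product_nn_integral_fold) (auto simp: pairs(1)[symmetric] pairs(2))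
      also have "\<dots> \<le> (\<integral>\<^sup>+h. ?V * indicator cube h \<partial>Pi\<^sub>M off (\<lambda>_. lborel))"
        by (intro nn_integral_mono inner)
      also have "\<dots> = ?V * emeasure (Pi\<^sub>M off (\<lambda>_. lborel)) cube"
        by (rule nn_integral_cmult_indicator) (auto simp: cube_def intro!: sets_PiM_I_finite)
      also have "\<dots> \<le> ?V * 1" by (intro mult_left_mono cube) simp
      finally show ?thesis by simp
    qed (simp add: emeasure_notin_sets)
  qed (use A meas in auto)
  have "AE h in ?M. h \<in> A \<longrightarrow> shell_bounds CARD('n) (\<lambda>lam \<delta> B. card (spectral_points (perturbed_identity h) lam \<delta>) \<le> B)"
    by (rule AE_shell_bounds) (auto simp: A_def intro: coercive_perturbed_identity)
  then show ?thesis
    using AE_space by eventually_elim (auto simp: A_def)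
qed

lemma opnorm_bounds:
  fixes \<beta> :: "real ^ 'n ^ 'n"
  assumes cutoff: "is_cutoff cutoff" and \<beta>: "coercive \<beta>"
    and bounds: "shell_bounds CARD('n) (\<lambda>lam \<delta> B. card (spectral_points \<beta> lam \<delta>) \<le> B)"
  shows "shell_bounds CARD('n) (\<lambda>lam \<delta> B. L1_Linf_opnorm (spectral_projector cutoff \<beta> lam \<delta>) \<le> ennreal B)"
  using bounds
proof (rule shell_bounds_mono)
  fix lam \<delta> B :: real
  assume "1 \<le> lam" "0 < \<delta>" "\<delta> < 1" and B: "card (spectral_points \<beta> lam \<delta>) \<le> B"
  then have "finite (spectral_points \<beta> lam \<delta>)"
    by (intro finite_subset[OF spectral_points_subset_shell[OF \<beta>] finite_shell])
  from L1_Linf_opnorm_le_card[OF cutoff \<open>0 < \<delta>\<close> this]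
  show "L1_Linf_opnorm (spectral_projector cutoff \<beta> lam \<delta>) \<le> ennreal B"
    by (rule order_trans) (rule ennreal_leI[OF B])
qed

theorem theorem1p3:
  fixes cutoff :: "real \<Rightarrow> real" and d :: nat
  assumes "d = CARD('n::finite)" and "is_cutoff cutoff"
  shows "\<forall>generically \<in> {generic_tori, generic_rectangular_tori}.
    generically (\<lambda>\<beta> :: real ^ 'n ^ 'n.
      \<forall>\<epsilon>>0. \<exists>C::real. \<forall>lam \<delta>. 1 \<le> lam \<longrightarrow> 0 < \<delta> \<longrightarrow> \<delta> < 1 \<longrightarrow>
        (\<delta> < lam powr (1 - 2 * real d - \<epsilon>) \<longrightarrow>
           L1_Linf_opnorm (spectral_projector cutoff \<beta> lam \<delta>) \<le> ennreal C) \<and>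
        (\<forall>a::int. int d \<le> a \<longrightarrow> a \<le> 2 * int d \<longrightarrow>
           lam powr (- real_of_int a) \<le> \<delta> \<longrightarrow> \<delta> \<le> lam powr (1 - real_of_int a) \<longrightarrow>
           L1_Linf_opnorm (spectral_projector cutoff \<beta> lam \<delta>) \<le>
             ennreal (C * \<delta> powr (1 - (real_of_int a + 1) / (real d + real_of_int a + 1))
               * lam powr (real d - 1 + (real_of_int a + 1) / (real d + real_of_int a + 1) + \<epsilon>))) \<and>
        (\<forall>a::int. (real d - 1) / 2 \<le> real_of_int a \<longrightarrow> a < int d \<longrightarrow>
           lam powr (- real_of_int a) \<le> \<delta> \<longrightarrow> \<delta> \<le> lam powr (1 - real_of_int a) \<longrightarrow>
           L1_Linf_opnorm (spectral_projector cutoff \<beta> lam \<delta>) \<le>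
             ennreal (C * \<delta> powr (1 - 1 / (real d + 1 - real_of_int a))
               * lam powr (real d - 1 + 1 / (real d + 1 - real_of_int a) + \<epsilon>))))"
proof -
  have "generic_tori (\<lambda>\<beta> :: real ^ 'n ^ 'n.
    shell_bounds CARD('n) (\<lambda>lam \<delta> B. L1_Linf_opnorm (spectral_projector cutoff \<beta> lam \<delta>) \<le> ennreal B))"
    unfolding generic_tori_def
    using AE_perturbed_shell_bounds
    by eventually_elim (auto simp: perturbed_identity_def[symmetric] intro!: opnorm_bounds assms(2) coercive_perturbed_identity)
  moreover have "generic_rectangular_tori (\<lambda>\<beta> :: real ^ 'n ^ 'n.
    shell_bounds CARD('n) (\<lambda>lam \<delta> B. L1_Linf_opnorm (spectral_projector cutoff \<beta> lam \<delta>) \<le> ennreal B))"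
    unfolding generic_rectangular_tori_def
    using AE_rectangular_shell_bounds
    by eventually_elim (auto intro!: opnorm_bounds assms(2) coercive_diagonal)
  ultimately show ?thesis
    unfolding shell_bounds_def bounds_at_def assms(1) by simp
qed

end
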